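(* Let $t=(\mathcal{G},\sigma,\Omega)$ be a simple symplectic symmetric triple with canonical decomposition $\mathcal{G}=\mathcal{K}\oplus\mathcal{P}$. Every Cartan subalgebra of $\mathcal{G}$ containing the centre $\mathcal{Z}(\mathcal{K})$ of $\mathcal{K}$ is contained in $\mathcal{K}$; in particular the ranks of $\mathcal{K}$ and of $\mathcal{G}$ are equal.
   Context: A symplectic symmetric triple is a triple $t=(\mathcal{G},\sigma,\Omega)$ where: (i) $\mathcal{G}$ is a finite-dimensional real Lie algebra; (ii) $\sigma$ is an involutive automorphism of $\mathcal{G}$ such that, writing $\mathcal{G}=\mathcal{K}\oplus\mathcal{P}$ with $\sigma=\mathrm{id}_{\mathcal{K}}\oplus(-\mathrm{id}_{\mathcal{P}})$ (canonical decomposition), one has $[\mathcal{P},\mathcal{P}]=\mathcal{K}$ and $\mathcal{K}$ acts faithfully on $\mathcal{P}$; (iii) $\Omega$ is a $\mathcal{K}$-invariant symplectic form on $\mathcal{P}$. It is simple if $\mathcal{G}$ is a simple Lie algebra. *)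

theory Defs
  imports "HOL-Analysis.Analysis"
begin

(* A Lie algebra is a real vector space type together with a bracket br.  Subalgebras
   are carrier sets, so that every notion below applies to the whole algebra (carrier
   UNIV) as well as to a subalgebra regarded as a Lie algebra in its own right. *)

definition lie_algebra :: "('g::real_vector \<Rightarrow> 'g \<Rightarrow> 'g) \<Rightarrow> bool" where
  "lie_algebra br \<longleftrightarrow>
     bilinear br \<and>
     (\<forall>x. br x x = 0) \<and>
     (\<forall>x y z. br x (br y z) + br y (br z x) + br z (br x y) = 0)"

definition lie_prod :: "('g::real_vector \<Rightarrow> 'g \<Rightarrow> 'g) \<Rightarrow> 'g set \<Rightarrow> 'g set \<Rightarrow> 'g set" where
  "lie_prod br A B = span {br x y |x y. x \<in> A \<and> y \<in> B}"

definition lie_subalgebra :: "('g::real_vector \<Rightarrow> 'g \<Rightarrow> 'g) \<Rightarrow> 'g set \<Rightarrow> bool" where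
  "lie_subalgebra br A \<longleftrightarrow> subspace A \<and> (\<forall>x\<in>A. \<forall>y\<in>A. br x y \<in> A)"

definition lie_ideal :: "('g::real_vector \<Rightarrow> 'g \<Rightarrow> 'g) \<Rightarrow> 'g set \<Rightarrow> bool" where
  "lie_ideal br I \<longleftrightarrow> subspace I \<and> (\<forall>x. \<forall>y\<in>I. br x y \<in> I)"

definition simple_lie_algebra :: "('g::real_vector \<Rightarrow> 'g \<Rightarrow> 'g) \<Rightarrow> bool" where
  "simple_lie_algebra br \<longleftrightarrow>
     lie_algebra br \<and>
     (\<exists>x y. br x y \<noteq> 0) \<and>
     (\<forall>I. lie_ideal br I \<longrightarrow> I = {0} \<or> I = UNIV)"

definition lie_centre :: "('g::real_vector \<Rightarrow> 'g \<Rightarrow> 'g) \<Rightarrow> 'g set \<Rightarrow> 'g set" where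
  "lie_centre br A = {z \<in> A. \<forall>x\<in>A. br z x = 0}"

definition lie_normalizer :: "('g::real_vector \<Rightarrow> 'g \<Rightarrow> 'g) \<Rightarrow> 'g set \<Rightarrow> 'g set \<Rightarrow> 'g set" where
  "lie_normalizer br A H = {x \<in> A. \<forall>h\<in>H. br x h \<in> H}"

primrec lower_central_series ::
    "('g::real_vector \<Rightarrow> 'g \<Rightarrow> 'g) \<Rightarrow> 'g set \<Rightarrow> nat \<Rightarrow> 'g set" where
  "lower_central_series br A 0 = A"
| "lower_central_series br A (Suc n) = lie_prod br A (lower_central_series br A n)"

definition nilpotent_subalgebra :: "('g::real_vector \<Rightarrow> 'g \<Rightarrow> 'g) \<Rightarrow> 'g set \<Rightarrow> bool" where
  "nilpotent_subalgebra br A \<longleftrightarrow>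
     lie_subalgebra br A \<and> (\<exists>n. lower_central_series br A n = {0})"

(* H is a Cartan subalgebra of A: nilpotent and equal to its own normalizer in A. *)
definition cartan_subalgebra :: "('g::real_vector \<Rightarrow> 'g \<Rightarrow> 'g) \<Rightarrow> 'g set \<Rightarrow> 'g set \<Rightarrow> bool" where
  "cartan_subalgebra br A H \<longleftrightarrow>
     H \<subseteq> A \<and> nilpotent_subalgebra br H \<and> lie_normalizer br A H = H"

(* The rank is the common dimension of the Cartan subalgebras.  As a relation it has no
   junk value: it asserts that Cartan subalgebras exist and all have dimension r. *)
definition has_lie_rank :: "('g::real_vector \<Rightarrow> 'g \<Rightarrow> 'g) \<Rightarrow> 'g set \<Rightarrow> nat \<Rightarrow> bool" where
  "has_lie_rank br A r \<longleftrightarrow>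
     (\<exists>H. cartan_subalgebra br A H) \<and> (\<forall>H. cartan_subalgebra br A H \<longrightarrow> dim H = r)"

definition involutive_automorphism ::
    "('g::real_vector \<Rightarrow> 'g \<Rightarrow> 'g) \<Rightarrow> ('g \<Rightarrow> 'g) \<Rightarrow> bool" where
  "involutive_automorphism br \<sigma> \<longleftrightarrow>
     linear \<sigma> \<and> (\<forall>x y. \<sigma> (br x y) = br (\<sigma> x) (\<sigma> y)) \<and> (\<forall>x. \<sigma> (\<sigma> x) = x)"

definition canonical_K :: "('g::real_vector \<Rightarrow> 'g) \<Rightarrow> 'g set" where
  "canonical_K \<sigma> = {x. \<sigma> x = x}"

definition canonical_P :: "('g::real_vector \<Rightarrow> 'g) \<Rightarrow> 'g set" where
  "canonical_P \<sigma> = {x. \<sigma> x = - x}"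

(* The values of \<Omega> outside the subspace V are irrelevant. *)
definition symplectic_form_on :: "'g::real_vector set \<Rightarrow> ('g \<Rightarrow> 'g \<Rightarrow> real) \<Rightarrow> bool" where
  "symplectic_form_on V \<Omega> \<longleftrightarrow>
     (\<forall>x\<in>V. \<forall>y\<in>V. \<forall>z\<in>V. \<Omega> (x + y) z = \<Omega> x z + \<Omega> y z \<and> \<Omega> z (x + y) = \<Omega> z x + \<Omega> z y) \<and>
     (\<forall>c. \<forall>x\<in>V. \<forall>y\<in>V. \<Omega> (c *\<^sub>R x) y = c * \<Omega> x y \<and> \<Omega> x (c *\<^sub>R y) = c * \<Omega> x y) \<and>
     (\<forall>x\<in>V. \<Omega> x x = 0) \<and>
     (\<forall>x\<in>V. (\<forall>y\<in>V. \<Omega> x y = 0) \<longrightarrow> x = 0)"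

(* The class euclidean_space only supplies finite-dimensionality; its inner product plays
   no role. *)
definition symplectic_symmetric_triple ::
    "('g::euclidean_space \<Rightarrow> 'g \<Rightarrow> 'g) \<Rightarrow> ('g \<Rightarrow> 'g) \<Rightarrow> ('g \<Rightarrow> 'g \<Rightarrow> real) \<Rightarrow> bool" where
  "symplectic_symmetric_triple br \<sigma> \<Omega> \<longleftrightarrow>
     lie_algebra br \<and>
     involutive_automorphism br \<sigma> \<and>
     lie_prod br (canonical_P \<sigma>) (canonical_P \<sigma>) = canonical_K \<sigma> \<and>
     (\<forall>k\<in>canonical_K \<sigma>. (\<forall>x\<in>canonical_P \<sigma>. br k x = 0) \<longrightarrow> k = 0) \<and>
     symplectic_form_on (canonical_P \<sigma>) \<Omega> \<and>
     (\<forall>k\<in>canonical_K \<sigma>. \<forall>x\<in>canonical_P \<sigma>. \<forall>y\<in>canonical_P \<sigma>.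
        \<Omega> (br k x) y + \<Omega> x (br k y) = 0)"

end

theory Submission
  imports Defs "HOL-Computational_Algebra.Fundamental_Theorem_Algebra"
begin

text \<open>
The symplectic form produces a distinguished element of the centre of \<open>K\<close>. Extended by zero on
\<open>K\<close>, the form \<open>\<Omega>\<close> is a 2-cocycle of the Lie algebra: this is exactly its \<open>K\<close>-invariance. As
the Killing form \<open>B\<close> of a simple Lie algebra is nondegenerate, \<open>\<Omega>(x, y) = B(D x, y)\<close> for some
endomorphism \<open>D\<close>, and the cocycle identity says that \<open>D\<close> is a derivation. Derivations are inner,
so \<open>D = ad z\<close>. Nondegeneracy of \<open>\<Omega>\<close> gives \<open>ker (ad z) = K\<close>, and orthogonality of \<open>K\<close> and \<open>P\<close>
gives \<open>[z, G] \<subseteq> P\<close>; in particular \<open>z\<close> lies in the centre of \<open>K\<close>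
(\<open>symplectic_triple_central_element\<close>). Since \<open>K \<inter> P = 0\<close>, an element killed by a power of \<open>ad z\<close>
is already killed by \<open>ad z\<close>, hence lies in \<open>K\<close>. A Cartan subalgebra that contains \<open>z\<close> is
nilpotent, so every element of it is killed by a power of \<open>ad z\<close>: it is contained in \<open>K\<close>.

The same element compares the ranks. A Cartan subalgebra \<open>C\<close> of \<open>K\<close> contains \<open>z\<close>, which
normalises it. If \<open>x\<close> in \<open>G\<close> normalises \<open>C\<close> then \<open>[x, z]\<close> lies in \<open>C \<inter> P = 0\<close>, so \<open>x\<close> is
in \<open>K\<close> and therefore in \<open>C\<close>. Thus every Cartan subalgebra of \<open>K\<close> is one of \<open>G\<close>, and it suffices
that \<open>K\<close> has a Cartan subalgebra (\<open>cartan_subalgebra_exists\<close>) and that all Cartan subalgebras of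
\<open>G\<close> have the same dimension (\<open>cartan_dim_unique\<close>).

Nondegeneracy of the Killing form is Cartan's criterion. The radical of the form is an ideal, so a
degenerate Killing form would vanish identically. In that case, for \<open>x\<close> in the complexification,
let \<open>Y\<close> act as the complex conjugate of \<open>\<lambda>\<close> on the generalised \<open>\<lambda>\<close>-eigenspace of \<open>ad x\<close>.
Brackets add eigenvalues, so \<open>Y\<close> is a derivation; as \<open>x\<close> is a sum of brackets, this forces
\<open>tr (ad x \<circ> Y) = 0\<close>. But that trace is the sum of the \<open>|\<lambda>|^2\<close> with multiplicities. So all
\<open>ad x\<close> would be nilpotent, which Engel's theorem excludes.

For the dimensions, write \<open>null0 h\<close> for the elements killed by a power of \<open>ad h\<close>. An element \<open>h\<close>
minimising \<open>dim (null0 h)\<close> in a Cartan subalgebra \<open>H\<close> satisfies \<open>null0 h = H\<close>. The conjugates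
under inner automorphisms \<open>exp (ad x)\<close> of elements of \<open>H\<close> near \<open>h\<close> fill a neighbourhood of \<open>h\<close>, so
the nullity is at least \<open>dim H\<close> near \<open>h\<close>. On the line from \<open>h\<close> to any \<open>y\<close>, on the other hand, the
nullity exceeds that of \<open>y\<close> only finitely often. Hence \<open>dim H \<le> dim (null0 y)\<close> for every \<open>y\<close>, and
taking \<open>y\<close> to be such an element of another Cartan subalgebra compares the two dimensions.
\<close>

section \<open>Generalised null spaces and the Fitting decomposition\<close>

definition nilspace :: "('a::real_vector \<Rightarrow> 'a) \<Rightarrow> 'a set" where
  "nilspace A = {v. \<exists>n. (A ^^ n) v = 0}"

lemma linear_funpow:
  fixes A :: "'a::real_vector \<Rightarrow> 'a"
  assumes "linear A" shows "linear (A ^^ n)"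
proof (induction n)
  case 0
  then show ?case by (simp add: linear_id[unfolded id_def] id_def)
next
  case (Suc n)
  then show ?case using assms linear_compose[of "A ^^ n" A] by (simp add: o_def)
qed

lemma funpow_zero_mono:
  fixes A :: "'a::real_vector \<Rightarrow> 'a"
  assumes "linear A" "(A ^^ n) v = 0" "n \<le> m" shows "(A ^^ m) v = 0"
proof -
  have "(A ^^ m) v = (A ^^ (m - n)) ((A ^^ n) v)"
    using assms(3) by (metis comp_apply funpow_add le_add_diff_inverse2)
  then show ?thesis using assms linear_0[OF linear_funpow[OF assms(1)]] by simp
qed

lemma subspace_nilspace:
  fixes A :: "'a::real_vector \<Rightarrow> 'a"
  assumes "linear A" shows "subspace (nilspace A)"
proof (rule subspaceI)
  show "0 \<in> nilspace A" using linear_0[OF linear_funpow[OF assms]] by (auto simp: nilspace_def)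
next
  fix x y assume "x \<in> nilspace A" "y \<in> nilspace A"
  then obtain m n where "(A ^^ m) x = 0" "(A ^^ n) y = 0" by (auto simp: nilspace_def)
  then have "(A ^^ max m n) x = 0" "(A ^^ max m n) y = 0"
    using funpow_zero_mono[OF assms] by (meson max.cobounded1 max.cobounded2)+
  then have "(A ^^ max m n) (x + y) = 0" by (simp add: linear_add[OF linear_funpow[OF assms]])
  then show "x + y \<in> nilspace A" by (auto simp: nilspace_def)
next
  fix c x assume "x \<in> nilspace A"
  then obtain m where "(A ^^ m) x = 0" by (auto simp: nilspace_def)
  then have "(A ^^ m) (c *\<^sub>R x) = 0" by (simp add: linear_cmul[OF linear_funpow[OF assms]])
  then show "c *\<^sub>R x \<in> nilspace A" by (auto simp: nilspace_def)
qed

text \<open>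
The kernels of the powers of \<open>A\<close> grow strictly up to the first exponent that kills \<open>v\<close>, so
this exponent is at most the dimension. A bound that does not depend on \<open>A\<close> is what makes
\<open>v \<in> nilspace A\<close> a polynomial condition on \<open>A\<close>.
\<close>
lemma funpow_DIM_eq_0:
  fixes A :: "'a::euclidean_space \<Rightarrow> 'a"
  assumes "linear A" "(A ^^ n) v = 0" shows "(A ^^ DIM('a)) v = 0"
proof (rule ccontr)
  assume c: "(A ^^ DIM('a)) v \<noteq> 0"
  define m where "m = (LEAST n. (A ^^ n) v = 0)"
  have m0: "(A ^^ m) v = 0" unfolding m_def using assms(2) by (rule LeastI)
  have mm: "(A ^^ k) v \<noteq> 0" if "k < m" for k using that not_less_Least unfolding m_def by blast
  have mD: "DIM('a) < m" using c funpow_zero_mono[OF assms(1) m0] by (meson not_less)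
  have "k \<le> dim {v. (A ^^ k) v = 0}" if "k \<le> m" for k
    using that
  proof (induction k)
    case (Suc k)
    have eq: "(A ^^ i) ((A ^^ j) v) = (A ^^ (i + j)) v" for i j by (simp add: funpow_add)
    let ?u = "(A ^^ (m - Suc k)) v"
    have "(A ^^ Suc k) ?u = 0" unfolding eq using Suc.prems m0 by simp
    moreover have "(A ^^ k) ?u \<noteq> 0" unfolding eq using Suc.prems mm by simp
    moreover have "{v. (A ^^ k) v = 0} \<subseteq> {v. (A ^^ Suc k) v = 0}"
      using funpow_zero_mono[OF assms(1)] by (metis (mono_tags, lifting) Collect_mono le_SucI order_refl)
    ultimately have "{v. (A ^^ k) v = 0} \<subset> {v. (A ^^ Suc k) v = 0}" by blast
    then have "dim {v. (A ^^ k) v = 0} < dim {v. (A ^^ Suc k) v = 0}"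
      using linear_subspace_kernel[OF linear_funpow[OF assms(1)]]
      by (metis dim_psubset span_eq_iff)
    then show ?case using Suc by simp
  qed simp
  from this[of m] have "m \<le> DIM('a)" by (meson dim_subset_UNIV le_trans order_refl)
  then show False using mD by simp
qed

lemma nilspace_eq:
  fixes A :: "'a::euclidean_space \<Rightarrow> 'a"
  assumes "linear A" shows "nilspace A = {v. (A ^^ DIM('a)) v = 0}"
  using funpow_DIM_eq_0[OF assms] by (auto simp: nilspace_def)

lemma nilspace_step:
  "A v \<in> nilspace A \<Longrightarrow> v \<in> nilspace A"
  unfolding nilspace_def mem_Collect_eq by (metis comp_apply funpow_Suc_right)

text \<open>
A power of \<open>A\<close> that kills the whole generalised null space is injective, hence bijective, on its
own range.
\<close>
lemma nilspace_range_decomp: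
  fixes A :: "'a::euclidean_space \<Rightarrow> 'a"
  assumes lin: "linear A"
  shows "nilspace A \<inter> range (A ^^ DIM('a)) = {0}"
    and "\<exists>u\<in>nilspace A. \<exists>w. v = u + (A ^^ DIM('a)) w"
proof -
  let ?N = "A ^^ DIM('a)"
  have lN: "linear ?N" by (rule linear_funpow[OF lin])
  have inj: "w = 0" if w: "w \<in> nilspace A" "w \<in> range ?N" for w
  proof -
    obtain u where u: "w = ?N u" using w by auto
    have "?N (?N u) = 0" using w u by (simp add: nilspace_eq[OF lin])
    then have "(A ^^ (DIM('a) + DIM('a))) u = 0" by (simp add: funpow_add)
    from funpow_DIM_eq_0[OF lin this] show ?thesis using u by simp
  qed
  then show int: "nilspace A \<inter> range ?N = {0}"
    using subspace_0[OF subspace_nilspace[OF lin]] linear_0[OF lN] by (auto simp: image_iff)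
  have sub: "subspace (range ?N)" by (rule linear_subspace_image[OF lN subspace_UNIV])
  have "inj_on ?N (range ?N)"
  proof (rule inj_onI)
    fix x y assume xy: "x \<in> range ?N" "y \<in> range ?N" "?N x = ?N y"
    have "x - y \<in> range ?N" using xy(1,2) by (rule subspace_diff[OF sub])
    moreover have "x - y \<in> nilspace A" unfolding nilspace_eq[OF lin] by (simp add: linear_diff[OF lN] xy)
    ultimately show "x = y" using inj by fastforce
  qed
  then have "dim (?N ` range ?N) = dim (range ?N)"
    using dim_image_eq[OF lN, of "range ?N"] by (metis span_eq_iff sub)
  then have "?N ` range ?N = range ?N"
    by (intro subspace_dim_equal linear_subspace_image[OF lN] sub) auto
  then obtain w where w: "?N v = ?N (?N w)" by (metis imageE rangeI)
  then have "v - ?N w \<in> nilspace A" unfolding nilspace_eq[OF lin] by (simp add: linear_diff[OF lN])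
  then show "\<exists>u\<in>nilspace A. \<exists>w. v = u + ?N w" by (metis diff_add_cancel)
qed

text \<open>
Kernel and range of a power of \<open>A\<close> are canonical, so the projection along the Fitting
decomposition commutes with everything that commutes with \<open>A\<close>; an arbitrary complement would not
give this.
\<close>
lemma fitting_projection:
  fixes A :: "'a::euclidean_space \<Rightarrow> 'a"
  assumes lin: "linear A"
  obtains G where "linear G" "\<And>v. (A ^^ DIM('a)) (G v) = 0"
    "\<And>v. v \<in> nilspace A \<Longrightarrow> G v = v"
    "\<And>S v. linear S \<Longrightarrow> (\<And>v. S (A v) = A (S v)) \<Longrightarrow> S (G v) = G (S v)"
proof -
  let ?N = "A ^^ DIM('a)"
  have lN: "linear ?N" by (rule linear_funpow[OF lin])
  have sK: "subspace (nilspace A)" by (rule subspace_nilspace[OF lin])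
  have sR: "subspace (range ?N)" by (rule linear_subspace_image[OF lN subspace_UNIV])
  define G where "G v = (SOME u. u \<in> nilspace A \<and> v - u \<in> range ?N)" for v
  have G: "G v \<in> nilspace A" "v - G v \<in> range ?N" for v
  proof -
    obtain u w where "u \<in> nilspace A" "v = u + ?N w" using nilspace_range_decomp(2)[OF lin] by blast
    then have "u \<in> nilspace A \<and> v - u \<in> range ?N" by simp
    from someI[of "\<lambda>u. u \<in> nilspace A \<and> v - u \<in> range ?N", OF this]
    show "G v \<in> nilspace A" "v - G v \<in> range ?N" unfolding G_def by auto
  qed
  have uniq: "G v = u" if "u \<in> nilspace A" "v - u \<in> range ?N" for u v
  proof -
    have "u - G v \<in> nilspace A" using subspace_diff[OF sK] that G by blast
    moreover have "u - G v \<in> range ?N" using subspace_diff[OF sR G(2)[of v] that(2)] by simp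
    ultimately have "u - G v = 0" using nilspace_range_decomp(1)[OF lin] by blast
    then show ?thesis by simp
  qed
  have "linear G"
  proof (rule linearI)
    fix x y show "G (x + y) = G x + G y"
      by (rule uniq) (use G subspace_add[OF sK] subspace_add[OF sR G(2)[of x] G(2)[of y]] in \<open>auto simp: algebra_simps\<close>)
  next
    fix c x show "G (c *\<^sub>R x) = c *\<^sub>R G x"
      by (rule uniq) (use G subspace_scale[OF sK] subspace_scale[OF sR G(2)[of x], of c] in \<open>auto simp: algebra_simps\<close>)
  qed
  moreover have "?N (G v) = 0" for v using G(1)[of v] nilspace_eq[OF lin] by auto
  moreover have "G v = v" if "v \<in> nilspace A" for v
    by (rule uniq[OF that]) (simp add: subspace_0[OF sR])
  moreover have "S (G v) = G (S v)" if "linear S" and c: "\<And>v. S (A v) = A (S v)" for S v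
  proof -
    have c': "S ((A ^^ n) v) = (A ^^ n) (S v)" for n v by (induction n) (auto simp: c)
    have "S (G v) \<in> nilspace A" using G(1)[of v] c' linear_0[OF \<open>linear S\<close>]
      unfolding nilspace_def mem_Collect_eq by metis
    moreover obtain w where "v - G v = ?N w" using G(2)[of v] by auto
    then have "S v - S (G v) = ?N (S w)" using c' linear_diff[OF \<open>linear S\<close>] by metis
    then have "S v - S (G v) \<in> range ?N" by simp
    ultimately show ?thesis by (rule uniq[symmetric])
  qed
  ultimately show ?thesis using that by blast
qed

section \<open>Traces\<close>

text \<open>
The trace is taken directly on endomorphisms of a Euclidean space; by \<open>tr_commute\<close> it does not
depend on the inner product.
\<close>
definition tr :: "('a::euclidean_space \<Rightarrow> 'a) \<Rightarrow> real" where
  "tr f = (\<Sum>b\<in>Basis. f b \<bullet> b)"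

lemma tr_add: "tr (\<lambda>v. f v + g v) = tr f + tr g"
  by (simp add: tr_def inner_add_left sum.distrib)

lemma tr_diff: "tr (\<lambda>v. f v - g v) = tr f - tr g"
  by (simp add: tr_def inner_diff_left sum_subtractf)

lemma tr_scale: "tr (\<lambda>v. c *\<^sub>R f v) = c * tr f"
  by (simp add: tr_def sum_distrib_left)

lemma tr_sum: "tr (\<lambda>v. \<Sum>i\<in>I. f i v) = (\<Sum>i\<in>I. tr (f i))"
  by (simp add: tr_def inner_sum_left sum.swap[of _ Basis])

lemma tr_zero: "tr (\<lambda>v. 0) = 0"
  by (simp add: tr_def)

lemma tr_commute:
  fixes f :: "'a::euclidean_space \<Rightarrow> 'b::euclidean_space" and g :: "'b \<Rightarrow> 'a"
  assumes "linear f" "linear g"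
  shows "tr (\<lambda>v. f (g v)) = tr (\<lambda>v. g (f v))"
proof -
  have 1: "f x \<bullet> c = (\<Sum>b\<in>Basis. (x \<bullet> b) * (f b \<bullet> c))" for x c
  proof -
    have "f x = f (\<Sum>b\<in>Basis. (x \<bullet> b) *\<^sub>R b)" by (simp add: euclidean_representation)
    then show ?thesis by (simp add: linear_sum[OF assms(1)] linear_cmul[OF assms(1)] inner_sum_left)
  qed
  have 2: "g x \<bullet> c = (\<Sum>b\<in>Basis. (x \<bullet> b) * (g b \<bullet> c))" for x c
  proof -
    have "g x = g (\<Sum>b\<in>Basis. (x \<bullet> b) *\<^sub>R b)" by (simp add: euclidean_representation)
    then show ?thesis by (simp add: linear_sum[OF assms(2)] linear_cmul[OF assms(2)] inner_sum_left)
  qed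
  have "tr (\<lambda>v. f (g v)) = (\<Sum>c\<in>Basis. \<Sum>b\<in>Basis. (g c \<bullet> b) * (f b \<bullet> c))"
    unfolding tr_def by (subst 1) simp
  also have "\<dots> = (\<Sum>b\<in>Basis. \<Sum>c\<in>Basis. (f b \<bullet> c) * (g c \<bullet> b))"
    by (subst sum.swap) (simp add: mult.commute)
  also have "\<dots> = tr (\<lambda>v. g (f v))" unfolding tr_def by (subst 2) simp
  finally show ?thesis .
qed

lemma tr_prod:
  fixes f :: "'a::euclidean_space \<times> 'b::euclidean_space \<Rightarrow> 'a \<times> 'b"
  shows "tr f = tr (\<lambda>u. fst (f (u, 0))) + tr (\<lambda>v. snd (f (0, v)))"
proof -
  have "tr f = (\<Sum>b\<in>(\<lambda>u. (u, 0)) ` Basis. f b \<bullet> b) + (\<Sum>b\<in>(\<lambda>v. (0, v)) ` Basis. f b \<bullet> b)"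
    unfolding tr_def Basis_prod_def by (rule sum.union_disjoint) auto
  also have "(\<Sum>b\<in>(\<lambda>u. (u, 0)) ` Basis. f b \<bullet> b) = (\<Sum>u\<in>Basis. fst (f (u, 0)) \<bullet> u)"
    by (subst sum.reindex) (auto simp: inj_on_def inner_prod_def)
  also have "(\<Sum>b\<in>(\<lambda>v. (0, v)) ` Basis. f b \<bullet> b) = (\<Sum>v\<in>Basis. snd (f (0, v)) \<bullet> v)"
    by (subst sum.reindex) (auto simp: inj_on_def inner_prod_def)
  finally show ?thesis by (simp add: tr_def)
qed

text \<open>
An orthogonal projection \<open>p\<close> onto the range of \<open>f\<close> gives \<open>tr f = tr (p \<circ> f) = tr (f \<circ> p)\<close>, which
replaces \<open>f\<close> by an operator that is easier to control.
\<close>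
lemma orthogonal_projection:
  fixes S :: "'a::euclidean_space set"
  assumes "subspace S"
  obtains p where "linear p" "\<And>x. p x \<in> S" "\<And>x. x \<in> S \<Longrightarrow> p x = x"
    "\<And>x y. p x \<bullet> y = p x \<bullet> p y"
proof -
  define p where "p x = (SOME y. y \<in> S \<and> (\<forall>w\<in>S. (x - y) \<bullet> w = 0))" for x
  have p: "p x \<in> S" "\<And>w. w \<in> S \<Longrightarrow> (x - p x) \<bullet> w = 0" for x
  proof -
    obtain y z where "y \<in> span S" "\<And>w. w \<in> span S \<Longrightarrow> orthogonal z w" "x = y + z"
      using orthogonal_subspace_decomp_exists[of S x] by metis
    then have "y \<in> S \<and> (\<forall>w\<in>S. (x - y) \<bullet> w = 0)"
      using span_eq_iff[THEN iffD2, OF assms] by (auto simp: orthogonal_def)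
    from someI[of "\<lambda>y. y \<in> S \<and> (\<forall>w\<in>S. (x - y) \<bullet> w = 0)", OF this]
    show "p x \<in> S" "\<And>w. w \<in> S \<Longrightarrow> (x - p x) \<bullet> w = 0" unfolding p_def by auto
  qed
  have uniq: "p x = y" if "y \<in> S" "\<And>w. w \<in> S \<Longrightarrow> (x - y) \<bullet> w = 0" for x y
  proof -
    have s: "p x - y \<in> S" using subspace_diff[OF assms] p that by blast
    have "(p x - y) \<bullet> (p x - y) = (x - y) \<bullet> (p x - y) - (x - p x) \<bullet> (p x - y)"
      by (simp add: inner_diff_left)
    also have "\<dots> = 0" using p(2)[OF s] that(2)[OF s] by simp
    finally show ?thesis by simp
  qed
  have "linear p"
  proof (rule linearI)
    fix x y show "p (x + y) = p x + p y"
    proof (rule uniq)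
      fix w assume "w \<in> S"
      then show "(x + y - (p x + p y)) \<bullet> w = 0"
        using p(2)[of w x] p(2)[of w y] by (simp add: algebra_simps inner_add_left inner_diff_left)
    qed (use p(1) subspace_add[OF assms] in blast)
  next
    fix c x show "p (c *\<^sub>R x) = c *\<^sub>R p x"
    proof (rule uniq)
      fix w assume "w \<in> S"
      then show "(c *\<^sub>R x - c *\<^sub>R p x) \<bullet> w = 0"
        using p(2)[of w x] by (simp flip: scaleR_diff_right)
    qed (use p(1) subspace_scale[OF assms] in blast)
  qed
  moreover have "p x = x" if "x \<in> S" for x by (rule uniq[OF that]) simp
  moreover have "p x \<bullet> y = p x \<bullet> p y" for x y
    using p(2)[OF p(1)[of x], of y] by (simp add: inner_diff_left inner_diff_right inner_commute)
  ultimately show ?thesis using that p(1) by blast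
qed

text \<open>
An idempotent has the trace of the orthogonal projection \<open>p\<close> onto its range, and
\<open>p b \<bullet> b\<close> is the square of the norm of \<open>p b\<close>.
\<close>
lemma tr_idempotent_pos:
  fixes E :: "'a::euclidean_space \<Rightarrow> 'a"
  assumes lin: "linear E" and idem: "\<And>v. E (E v) = E v" and "E w \<noteq> 0"
  shows "tr E > 0"
proof -
  obtain p where p: "linear p" "\<And>x. p x \<in> range E" "\<And>x. x \<in> range E \<Longrightarrow> p x = x"
    "\<And>x y. p x \<bullet> y = p x \<bullet> p y"
    using orthogonal_projection[OF linear_subspace_image[OF lin subspace_UNIV]] by metis
  have "p (E v) = E v" for v using p(3) by blast
  then have "tr E = tr (\<lambda>v. p (E v))" by simp
  also have "\<dots> = tr (\<lambda>v. E (p v))" by (rule tr_commute[OF p(1) lin])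
  also have "\<dots> = tr p"
  proof -
    have "E (p v) = p v" for v using p(2)[of v] idem by (metis imageE)
    then show ?thesis by simp
  qed
  also have "\<dots> = (\<Sum>b\<in>Basis. (p b \<bullet> p b))" unfolding tr_def using p(4) by simp
  finally have eq: "tr E = (\<Sum>b\<in>Basis. (p b \<bullet> p b))" .
  have "\<exists>b\<in>Basis. p b \<noteq> 0"
  proof (rule ccontr)
    assume "\<not> ?thesis"
    then have "p x = 0" for x
      using linear_eq_on_span[OF p(1) linear_zero, of Basis x] by (simp add: span_Basis)
    then show False using assms(3) p(3) by (metis rangeI)
  qed
  then show ?thesis unfolding eq by (auto intro!: sum_pos2)
qed

text \<open>
Induction on the rank: with \<open>p\<close> the orthogonal projection onto the range of \<open>T\<close>, the operator
\<open>T \<circ> p\<close> has the same trace, is nilpotent, and has the strictly smaller range of \<open>T \<circ> T\<close>.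
\<close>
lemma tr_nilpotent:
  fixes T :: "'a::euclidean_space \<Rightarrow> 'a"
  assumes "linear T" "\<And>v. (T ^^ n) v = 0"
  shows "tr T = 0"
  using assms
proof (induction "dim (range T)" arbitrary: T rule: less_induct)
  case less
  show ?case
  proof (cases "\<forall>v. T v = 0")
    case True
    then show ?thesis by (simp add: tr_def)
  next
    case False
    have sR: "subspace (range T)" by (rule linear_subspace_image[OF less(2) subspace_UNIV])
    obtain p where p: "linear p" "\<And>x. p x \<in> range T" "\<And>x. x \<in> range T \<Longrightarrow> p x = x"
      using orthogonal_projection[OF sR] by metis
    have pT: "p (T v) = T v" for v using p(3) by blast
    let ?S = "\<lambda>v. T (p v)"
    have lS: "linear ?S" using linear_compose[OF p(1) less(2)] by (simp add: o_def)
    have "(?S ^^ k) v = (T ^^ k) (if k = 0 then v else p v)" for k v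
    proof (induction k)
      case (Suc k)
      have "p ((T ^^ k) (p v)) = (T ^^ k) (p v)"
        by (cases k) (use p(2,3) in auto)
      then show ?case using Suc by (auto simp: pT)
    qed auto
    moreover have "(T ^^ Suc n) v = 0" for v using less(3) linear_0[OF less(2)] by simp
    ultimately have S0: "(?S ^^ n) v = 0" for v using less(3)[of "p v"] less(3)[of v] by (cases n) (auto simp del: funpow.simps)
    have sS: "subspace (range ?S)" by (rule linear_subspace_image[OF lS subspace_UNIV])
    have "range ?S \<noteq> range T"
    proof
      assume eq: "range ?S = range T"
      have "\<exists>v. (T ^^ Suc k) v \<noteq> 0" for k
      proof (induction k)
        case 0 then show ?case using False by simp
      next
        case (Suc k)
        then obtain v where v: "(T ^^ k) (T v) \<noteq> 0" by (auto simp: funpow_swap1)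
        obtain u where "T v = T (p u)" using eq by (metis (no_types, lifting) imageE rangeI)
        moreover obtain w where "p u = T w" using p(2) by blast
        ultimately have "(T ^^ k) (T (T w)) \<noteq> 0" using v by simp
        then show ?case by (auto simp: funpow_swap1)
      qed
      then show False using \<open>\<And>v. (T ^^ Suc n) v = 0\<close> by blast
    qed
    then have "range ?S \<subset> range T" by blast
    then have "dim (range ?S) < dim (range T)"
      using dim_psubset sR sS by (metis span_eq_iff)
    from less(1)[OF this lS S0] have "tr ?S = 0" .
    moreover have "tr T = tr (\<lambda>v. p (T v))" by (simp add: pT)
    moreover have "\<dots> = tr ?S" by (rule tr_commute[OF p(1) less(2)])
    ultimately show ?thesis by simp
  qed
qed

section \<open>Spectral decomposition of complex linear operators\<close>

text \<open>
A complex vector space is represented by a real one with an operator \<open>J\<close> of square \<open>-1\<close>, so that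
real dimension, real trace and the Fitting decomposition remain applicable.
\<close>
locale complex_structure =
  fixes J :: "'v::euclidean_space \<Rightarrow> 'v"
  assumes linear_J: "linear J" and J_J: "J (J v) = - v"
begin

definition cscale :: "complex \<Rightarrow> 'v \<Rightarrow> 'v" (infixr "\<bullet>\<^sub>J" 75) where
  "cscale z v = Re z *\<^sub>R v + Im z *\<^sub>R J v"

lemmas J_simps = linear_add[OF linear_J] linear_diff[OF linear_J] linear_neg[OF linear_J]
  linear_cmul[OF linear_J] linear_0[OF linear_J]

lemma cscale_simps:
  "(z + w) \<bullet>\<^sub>J v = z \<bullet>\<^sub>J v + w \<bullet>\<^sub>J v"
  "z \<bullet>\<^sub>J (u + v) = z \<bullet>\<^sub>J u + z \<bullet>\<^sub>J v"
  "z \<bullet>\<^sub>J (u - v) = z \<bullet>\<^sub>J u - z \<bullet>\<^sub>J v"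
  "z \<bullet>\<^sub>J (w \<bullet>\<^sub>J v) = (z * w) \<bullet>\<^sub>J v"
  "0 \<bullet>\<^sub>J v = 0" "1 \<bullet>\<^sub>J v = v" "z \<bullet>\<^sub>J 0 = 0" "(- z) \<bullet>\<^sub>J v = - (z \<bullet>\<^sub>J v)"
  "z \<bullet>\<^sub>J (r *\<^sub>R v) = r *\<^sub>R (z \<bullet>\<^sub>J v)"
  by (auto simp: cscale_def J_simps J_J algebra_simps)

lemma cscale_of_real: "of_real r \<bullet>\<^sub>J v = r *\<^sub>R v"
  by (simp add: cscale_def)

lemma cscale_eq_0: "z \<bullet>\<^sub>J v = 0 \<longleftrightarrow> z = 0 \<or> v = 0"
  by (metis cscale_simps(4,5,6,7) left_inverse)

lemma linear_cscale: "linear (cscale z)"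
  by (rule linearI) (auto simp: cscale_simps)

lemma commute_cscale:
  assumes "linear S" "\<And>v. S (J v) = J (S v)"
  shows "S (z \<bullet>\<^sub>J v) = z \<bullet>\<^sub>J S v"
  by (simp add: cscale_def linear_add[OF assms(1)] linear_cmul[OF assms(1)] assms(2))

end

locale complex_operator = complex_structure J for J :: "'v::euclidean_space \<Rightarrow> 'v" +
  fixes X :: "'v \<Rightarrow> 'v"
  assumes linear_X: "linear X" and X_J: "X (J v) = J (X v)"
begin

lemmas X_simps = linear_add[OF linear_X] linear_diff[OF linear_X] linear_neg[OF linear_X]
  linear_cmul[OF linear_X] linear_0[OF linear_X] commute_cscale[OF linear_X X_J]

definition poly_act :: "complex poly \<Rightarrow> 'v \<Rightarrow> 'v" where
  "poly_act p v = fold_coeffs (\<lambda>a w. a \<bullet>\<^sub>J v + X w) p 0"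

lemma poly_act_0 [simp]: "poly_act 0 v = 0"
  by (simp add: poly_act_def)

lemma poly_act_pCons [simp]: "poly_act (pCons a p) v = a \<bullet>\<^sub>J v + X (poly_act p v)"
  by (cases "a = 0 \<and> p = 0") (auto simp: poly_act_def cscale_simps X_simps)

lemma poly_act_add: "poly_act (p + q) v = poly_act p v + poly_act q v"
  by (induction p q rule: poly_induct2) (auto simp: cscale_simps X_simps)

lemma poly_act_smult: "poly_act (smult c p) v = c \<bullet>\<^sub>J poly_act p v"
  by (induction p) (auto simp: cscale_simps X_simps)

lemma poly_act_linear_factor:
  "poly_act ([:-a, 1:] * p) v = X (poly_act p v) - a \<bullet>\<^sub>J poly_act p v"
  using poly_act_add[of "pCons 0 p" "smult (-a) p" v] poly_act_smult[of "-a" p v]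
  by (simp add: cscale_simps)

lemma poly_act_monom: "poly_act (monom c k) v = (X ^^ k) (c \<bullet>\<^sub>J v)"
  by (induction k) (auto simp: monom_Suc monom_0 cscale_simps X_simps)

lemma poly_act_sum: "finite I \<Longrightarrow> poly_act (\<Sum>i\<in>I. p i) v = (\<Sum>i\<in>I. poly_act (p i) v)"
  by (induction I rule: finite_induct) (auto simp: poly_act_add)

lemma annihilating_poly: "\<exists>p. p \<noteq> 0 \<and> poly_act p v = 0"
proof -
  let ?f = "\<lambda>k. (X ^^ k) v"
  show ?thesis
  proof (cases "inj_on ?f {..DIM('v)}")
    case False
    then obtain i j where ij: "i \<noteq> j" "?f i = ?f j" by (auto simp: inj_on_def)
    have "poly_act (monom 1 i + monom (-1) j) v = 0"
      using ij by (simp add: poly_act_add poly_act_monom cscale_simps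
        linear_neg[OF linear_funpow[OF linear_X]])
    moreover have "coeff (monom 1 i + monom (-1) j :: complex poly) i \<noteq> 0" using ij by simp
    then have "monom 1 i + monom (-1) j \<noteq> (0::complex poly)" by (metis coeff_0)
    ultimately show ?thesis by blast
  next
    case True
    have "card (?f ` {..DIM('v)}) > DIM('v)" using True by (simp add: card_image)
    then have "dependent (?f ` {..DIM('v)})" using independent_card_le by (metis not_less)
    then obtain c w where c: "(\<Sum>x\<in>?f ` {..DIM('v)}. c x *\<^sub>R x) = 0" and "w \<in> ?f ` {..DIM('v)}" "c w \<noteq> 0"
      using dependent_finite[of "?f ` {..DIM('v)}"] by (metis (no_types, lifting) finite_atMost finite_imageI)
    then obtain i where i: "i \<le> DIM('v)" "c (?f i) \<noteq> 0" by (metis (no_types, lifting) atMost_iff imageE)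
    let ?p = "\<Sum>k\<in>{..DIM('v)}. monom (of_real (c (?f k)) :: complex) k"
    have "poly_act ?p v = (\<Sum>k\<in>{..DIM('v)}. c (?f k) *\<^sub>R ?f k)"
      by (simp add: poly_act_sum poly_act_monom cscale_of_real linear_cmul[OF linear_funpow[OF linear_X]])
    also have "\<dots> = 0" using c True by (simp add: sum.reindex)
    finally have "poly_act ?p v = 0" .
    moreover have "coeff ?p i \<noteq> 0" using i by (simp add: coeff_sum)
    then have "?p \<noteq> 0" by (metis coeff_0)
    ultimately show ?thesis by blast
  qed
qed

text \<open>
A nonzero complex polynomial of least degree annihilating \<open>v\<close> has a root \<open>a\<close>; applying the
cofactor of \<open>X - a\<close> to \<open>v\<close> gives an eigenvector, and it stays inside every invariant subspace
containing \<open>v\<close>.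
\<close>
lemma eigenvector_exists:
  assumes "subspace S" "\<And>v. v \<in> S \<Longrightarrow> X v \<in> S" "\<And>v. v \<in> S \<Longrightarrow> J v \<in> S"
    and v: "v \<in> S" "v \<noteq> 0"
  obtains a w where "w \<in> S" "w \<noteq> 0" "X w = a \<bullet>\<^sub>J w"
proof -
  have inS: "poly_act p v \<in> S" for p
  proof (induction p)
    case (pCons a p)
    have "a \<bullet>\<^sub>J v \<in> S" unfolding cscale_def
      using assms(3)[OF v(1)] v(1) by (intro subspace_add[OF assms(1)] subspace_scale[OF assms(1)])
    then show ?case using assms(2)[OF pCons(2)] subspace_add[OF assms(1)] by simp
  qed (simp add: subspace_0[OF assms(1)])
  define P where "P p \<longleftrightarrow> p \<noteq> 0 \<and> poly_act p v = 0" for p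
  obtain p where p: "P p" "\<And>q. P q \<Longrightarrow> degree p \<le> degree q"
    using annihilating_poly[of v] ex_has_least_nat[of P _ degree] unfolding P_def[symmetric] by blast
  have "degree p \<noteq> 0"
  proof
    assume "degree p = 0"
    then obtain c where "p = [:c:]" by (meson degree_eq_zeroE)
    then show False using p(1) v by (auto simp: P_def X_simps cscale_eq_0)
  qed
  then obtain a where "poly p a = 0"
    using fundamental_theorem_of_algebra constant_degree by metis
  then obtain q where q: "p = [:-a, 1:] * q" by (metis dvdE poly_eq_0_iff_dvd)
  have "q \<noteq> 0" using p q by (auto simp: P_def)
  then have "degree q < degree p" unfolding q by (subst degree_mult_eq) auto
  then have "poly_act q v \<noteq> 0" using p \<open>q \<noteq> 0\<close> by (meson P_def leD)
  moreover have "X (poly_act q v) = a \<bullet>\<^sub>J poly_act q v"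
    using p(1) unfolding P_def q poly_act_linear_factor by simp
  ultimately show ?thesis using that inS by blast
qed

definition shifted :: "complex \<Rightarrow> 'v \<Rightarrow> 'v" where
  "shifted z v = X v - z \<bullet>\<^sub>J v"

lemma linear_shifted: "linear (shifted z)"
  unfolding shifted_def by (intro linear_compose_sub linear_X linear_cscale)

lemma commute_shifted:
  assumes "linear S" "\<And>v. S (J v) = J (S v)" "\<And>v. S (X v) = X (S v)"
  shows "S (shifted z v) = shifted z (S v)"
  by (simp add: shifted_def linear_diff[OF assms(1)] commute_cscale[OF assms(1,2)] assms(3))

lemma commute_shifted_pow:
  assumes "linear S" "\<And>v. S (J v) = J (S v)" "\<And>v. S (X v) = X (S v)"
  shows "S ((shifted z ^^ n) v) = (shifted z ^^ n) (S v)"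
  by (induction n) (auto simp: commute_shifted[OF assms])

definition commuting :: "('v \<Rightarrow> 'v) \<Rightarrow> bool" where
  "commuting S \<longleftrightarrow> linear S \<and> (\<forall>v. S (J v) = J (S v)) \<and> (\<forall>v. S (X v) = X (S v))"

text \<open>
The spectral projections are split off one at a time: as long as \<open>F\<close> is not zero its range
contains an eigenvector of \<open>X\<close>, and removing the corresponding Fitting projection \<open>G\<close> from \<open>F\<close>
strictly shrinks the range.
\<close>
lemma spectral_family_aux:
  assumes "commuting F" "\<And>v. F (F v) = F v"
  shows "\<exists>L E. finite L \<and> (\<forall>z v. z \<notin> L \<longrightarrow> E z v = 0) \<and> (\<forall>z. commuting (E z)) \<and>
     (\<forall>z v. (shifted z ^^ DIM('v)) (E z v) = 0) \<and> (\<forall>v. F v = (\<Sum>z\<in>L. E z v))"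
  using assms
proof (induction "dim (range F)" arbitrary: F rule: less_induct)
  case less
  note F = less(2)[unfolded commuting_def]
  have linF: "linear F" using F by blast
  note Fs = linear_diff[OF linF] linear_add[OF linF]
  show ?case
  proof (cases "\<forall>v. F v = 0")
    case True
    have "commuting (\<lambda>v. 0)" by (simp add: commuting_def linear_zero J_simps X_simps)
    then show ?thesis using True
      by (intro exI[of _ "{}"] exI[of _ "\<lambda>z v. 0"]) (auto simp: linear_0[OF linear_funpow[OF linear_shifted]])
  next
    case False
    then obtain v0 where v0: "F v0 \<noteq> 0" by blast
    have sF: "subspace (range F)" by (rule linear_subspace_image[OF linF subspace_UNIV])
    have r1: "X v \<in> range F" if "v \<in> range F" for v 
      using that F[THEN conjunct2, THEN conjunct2, rule_format, symmetric] by auto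
    have r2: "J v \<in> range F" if "v \<in> range F" for v
      using that F[THEN conjunct2, THEN conjunct1, rule_format, symmetric] by auto
    obtain a w where w: "w \<in> range F" "w \<noteq> 0" "X w = a \<bullet>\<^sub>J w"
      using eigenvector_exists[OF sF r1 r2 _ v0] by blast
    obtain G where G: "linear G" "\<And>v. (shifted a ^^ DIM('v)) (G v) = 0"
      "\<And>v. v \<in> nilspace (shifted a) \<Longrightarrow> G v = v"
      "\<And>S v. linear S \<Longrightarrow> (\<And>v. S (shifted a v) = shifted a (S v)) \<Longrightarrow> S (G v) = G (S v)"
      using fitting_projection[OF linear_shifted] by metis
    have GJ: "G (J v) = J (G v)" for v
      by (rule G(4)[symmetric, OF linear_J]) (simp add: commute_shifted linear_J X_J)
    have GX: "G (X v) = X (G v)" for v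
      by (rule G(4)[symmetric, OF linear_X]) (simp add: commute_shifted linear_X X_J)
    have GF: "F (G v) = G (F v)" for v
      by (rule G(4)[OF linF]) (use F in \<open>simp add: commute_shifted\<close>)
    have GG: "G (G v) = G v" for v by (rule G(3)) (use G(2) in \<open>auto simp: nilspace_def\<close>)
    define F' where "F' v = F v - G (F v)" for v
    have cGF: "commuting (\<lambda>v. G (F v))" using F GJ GX linear_compose[OF linF G(1)]
      by (simp add: commuting_def o_def)
    have "commuting F'" using F cGF unfolding commuting_def F'_def
      by (simp add: linear_compose_sub J_simps X_simps)
    moreover have "F' (F' v) = F' v" for v unfolding F'_def
      by (simp add: Fs linear_diff[OF G(1)] less(3) GF GG)
    moreover have "dim (range F') < dim (range F)"
    proof -
      have linF': "linear F'" using \<open>commuting F'\<close> by (simp add: commuting_def)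
      have sF': "subspace (range F')" by (rule linear_subspace_image[OF linF' subspace_UNIV])
      have "F' v = F (v - G v)" for v by (simp add: F'_def Fs GF)
      then have "range F' \<subseteq> range F" by auto
      moreover have Fw: "F w = w" using w(1) less(3) by auto
      have "shifted a w = 0" using w by (simp add: shifted_def)
      then have "w \<in> nilspace (shifted a)" unfolding nilspace_def mem_Collect_eq
        by (intro exI[of _ 1]) simp
      then have "F' w = 0" by (simp add: F'_def Fw G(3))
      then have "w \<notin> range F'" using w(2) \<open>\<And>v. F' (F' v) = F' v\<close> by auto
      ultimately have "range F' \<subset> range F" using w(1) by blast
      then show ?thesis using dim_psubset sF sF' by (metis span_eq_iff)
    qed
    ultimately obtain L E where L: "finite L" "\<And>z v. z \<notin> L \<Longrightarrow> E z v = 0" "\<And>z. commuting (E z)"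
      "\<And>z v. (shifted z ^^ DIM('v)) (E z v) = 0" "\<And>v. F' v = (\<Sum>z\<in>L. E z v)"
      using less(1)[of F'] by metis
    \<comment> \<open>If \<open>a\<close> already occurred in the recursive family, its two components are added.\<close>
    define E' where "E' z v = (if z = a then E a v + G (F v) else E z v)" for z v
    have c: "commuting (E' z)" for z
    proof (cases "z = a")
      case True
      have "E' z = (\<lambda>v. E a v + G (F v))" by (auto simp: True E'_def)
      then show ?thesis using L(3)[of a] cGF
        by (simp add: commuting_def linear_compose_add J_simps X_simps)
    next
      case False
      then have "E' z = E z" by (auto simp: E'_def)
      then show ?thesis using L by simp
    qed
    have s: "(shifted z ^^ DIM('v)) (E' z v) = 0" for z v
      using L(4) G(2) by (simp add: E'_def linear_add[OF linear_funpow[OF linear_shifted]])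
    have "F v = (\<Sum>z\<in>insert a L. E' z v)" for v
    proof -
      have "(\<Sum>z\<in>insert a L. E' z v) = (\<Sum>z\<in>insert a L. E z v + (if z = a then G (F v) else 0))"
        by (rule sum.cong) (auto simp: E'_def)
      also have "\<dots> = (\<Sum>z\<in>insert a L. E z v) + G (F v)" using L(1) by (simp add: sum.distrib)
      also have "(\<Sum>z\<in>insert a L. E z v) = F' v"
        unfolding L(5) using L(1,2) by (intro sum.mono_neutral_right) auto
      finally show ?thesis by (simp add: F'_def)
    qed
    then show ?thesis using L(1,2) c s
      by (intro exI[of _ "insert a L"] exI[of _ E']) (auto simp: E'_def)
  qed
qed

lemma nilspace_shifted_disjoint:
  assumes "v \<in> nilspace (shifted a)" "v \<in> nilspace (shifted b)" "a \<noteq> b"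
  shows "v = 0"
proof -
  have cm: "shifted a (shifted b u) = shifted b (shifted a u)" for u
    by (rule commute_shifted[OF linear_shifted])
      (auto simp: shifted_def J_simps X_simps X_J cscale_def)
  have *: "v = 0" if "(shifted a ^^ n) v = 0" "v \<in> nilspace (shifted b)" for n v
    using that
  proof (induction n arbitrary: v)
    case (Suc n)
    have inb: "shifted a v \<in> nilspace (shifted b)"
    proof -
      obtain m where "(shifted b ^^ m) v = 0" using Suc by (auto simp: nilspace_def)
      moreover have "(shifted b ^^ m) (shifted a v) = shifted a ((shifted b ^^ m) v)"
        by (induction m) (auto simp: cm)
      ultimately show ?thesis using linear_0[OF linear_shifted] unfolding nilspace_def by auto
    qed
    have "(shifted a ^^ n) (shifted a v) = 0" using Suc.prems(1) by (simp add: funpow_swap1)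
    then have "shifted a v = 0" using Suc.IH inb by blast
    then have "X v = a \<bullet>\<^sub>J v" by (simp add: shifted_def)
    then have sb: "shifted b v = (a - b) \<bullet>\<^sub>J v"
      by (simp add: shifted_def cscale_def algebra_simps)
    obtain m where m: "(shifted b ^^ m) v = 0" using Suc by (auto simp: nilspace_def)
    have "(shifted b ^^ m) v = ((a - b) ^ m) \<bullet>\<^sub>J v"
    proof (induction m)
      case (Suc m)
      have "shifted b (((a - b) ^ m) \<bullet>\<^sub>J v) = ((a - b) ^ m) \<bullet>\<^sub>J shifted b v"
        by (simp add: shifted_def cscale_simps X_simps mult.commute)
      then show ?case using Suc by (simp add: sb cscale_simps mult.commute)
    qed (simp add: cscale_simps)
    then show ?case using m assms(3) by (simp add: cscale_eq_0)
  qed auto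
  obtain n where "(shifted a ^^ n) v = 0" using assms by (auto simp: nilspace_def)
  then show ?thesis using * assms(2) by blast
qed

text \<open>
The components of the identity are projections onto the generalised eigenspaces: each commutes
with \<open>X\<close>, so it maps a generalised eigenspace into itself, and distinct generalised eigenspaces
meet only in zero.
\<close>
lemma spectral_family:
  obtains L E where "finite L" "\<And>z. linear (E z)" "\<And>z v. E z (J v) = J (E z v)" "\<And>z v. E z (X v) = X (E z v)"
    "\<And>v. v = (\<Sum>z\<in>L. E z v)"
    "\<And>z v. E z v \<in> nilspace (shifted z)" "\<And>z v. E z (E z v) = E z v"
    "\<And>z u v. v \<in> nilspace (shifted z) \<Longrightarrow> z \<noteq> u \<Longrightarrow> E u v = 0"
    "\<And>z v. v \<in> nilspace (shifted z) \<Longrightarrow> E z v = v" "\<And>z v. z \<notin> L \<Longrightarrow> E z v = 0"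
proof -
  have "commuting (\<lambda>v. v)" by (simp add: commuting_def linear_id[unfolded id_def])
  then obtain L E where L: "finite L" "\<And>z v. z \<notin> L \<Longrightarrow> E z v = 0" "\<And>z. commuting (E z)"
    "\<And>z v. (shifted z ^^ DIM('v)) (E z v) = 0" "\<And>v. v = (\<Sum>z\<in>L. E z v)"
    using spectral_family_aux[of "\<lambda>v. v"] by metis
  have c: "linear (E z)" "E z (J v) = J (E z v)" "E z (X v) = X (E z v)" for z v
    using L(3) unfolding commuting_def by auto
  have nil: "E z v \<in> nilspace (shifted z)" for z v using L(4) by (auto simp: nilspace_def)
  have other: "E u v = 0" if v: "v \<in> nilspace (shifted z)" and zu: "z \<noteq> u" for u v z
  proof -
    obtain n where "(shifted z ^^ n) v = 0" using v by (auto simp: nilspace_def)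
    then have "(shifted z ^^ n) (E u v) = 0"
      using commute_shifted_pow[OF c(1)[of u] c(2,3), where z = z and n = n and v = v] linear_0[OF c(1)] by simp
    then have "E u v \<in> nilspace (shifted z)" by (auto simp: nilspace_def)
    then show ?thesis using nilspace_shifted_disjoint nil zu by blast
  qed
  have self: "E z v = v" if "v \<in> nilspace (shifted z)" for z v
  proof -
    have "v = (\<Sum>u\<in>L. E u v)" by (rule L(5))
    also have "\<dots> = (\<Sum>u\<in>L. if u = z then E z v else 0)"
      by (rule sum.cong) (use other[OF that] in auto)
    also have "\<dots> = E z v" using L(1,2) by (simp add: sum.delta)
    finally show ?thesis by simp
  qed
  show ?thesis
    by (rule that[of L E]) (fact L(1) L(2) L(5) c nil self[OF nil] other self)+
qed

end

section \<open>Engel's theorem\<close>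

locale lie_alg =
  fixes br :: "'g::euclidean_space \<Rightarrow> 'g \<Rightarrow> 'g"
  assumes lie: "lie_algebra br"
begin

lemma bilinear_br: "bilinear br"
  using lie by (simp add: lie_algebra_def)

lemma linear_br: "linear (br x)" and linear_br_left: "linear (\<lambda>x. br x y)"
  using bilinear_br by (auto simp: bilinear_def)

lemmas br_simps = bilinear_ladd[OF bilinear_br] bilinear_radd[OF bilinear_br]
  bilinear_lsub[OF bilinear_br] bilinear_rsub[OF bilinear_br]
  bilinear_lneg[OF bilinear_br] bilinear_rneg[OF bilinear_br]
  bilinear_lmul[OF bilinear_br] bilinear_rmul[OF bilinear_br]
  bilinear_lzero[OF bilinear_br] bilinear_rzero[OF bilinear_br]

lemma br_self [simp]: "br x x = 0"
  using lie by (simp add: lie_algebra_def)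

lemma br_anti: "br y x = - br x y"
proof -
  have "br (x + y) (x + y) = br x x + br x y + (br y x + br y y)"
    by (simp only: br_simps add.assoc add.commute add.left_commute)
  then have "br y x + br x y = 0" by (simp add: add.commute)
  then show ?thesis by (simp only: eq_neg_iff_add_eq_0)
qed

lemma br_jacobi_sum: "br x (br y z) + br y (br z x) + br z (br x y) = 0"
  using lie by (simp add: lie_algebra_def)

lemma br_jacobi: "br x (br y z) = br (br x y) z + br y (br x z)"
proof -
  have "br y (br z x) = - br y (br x z)" by (subst br_anti[of z x]) (simp add: br_simps)
  moreover have "br z (br x y) = - br (br x y) z" by (rule br_anti)
  ultimately have "br x (br y z) - br y (br x z) - br (br x y) z = 0"
    using br_jacobi_sum[of x y z] by simp
  then show ?thesis by (simp add: algebra_simps)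
qed

lemma br_br: "br (br x y) z = br x (br y z) - br y (br x z)"
  using br_jacobi[of x y z] by simp

lemma lie_subalgebra_UNIV: "lie_subalgebra br UNIV"
  by (simp add: lie_subalgebra_def)

text \<open>
Working relative to the subspaces \<open>U \<subset> W\<close> avoids quotient spaces. For a maximal proper subalgebra
\<open>M\<close> of \<open>L\<close> the induction hypothesis, applied to the action of \<open>M\<close> on \<open>L\<close> modulo \<open>M\<close>, yields \<open>v\<close>
outside \<open>M\<close> normalising \<open>M\<close>; by maximality \<open>L = M + span {v}\<close>. Applied to \<open>W\<close> modulo \<open>U\<close> it shows
that the vectors sent into \<open>U\<close> by \<open>M\<close> are not all in \<open>U\<close>. They are stable under \<open>v\<close>, which acts
nilpotently, so one of them outside \<open>U\<close> is sent into \<open>U\<close> by \<open>v\<close> as well.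
\<close>
lemma engel:
  assumes "lie_subalgebra br L" "subspace U" "subspace W" "U \<subset> W"
    "\<And>x w. x \<in> L \<Longrightarrow> w \<in> W \<Longrightarrow> br x w \<in> W" "\<And>x u. x \<in> L \<Longrightarrow> u \<in> U \<Longrightarrow> br x u \<in> U"
    "\<And>x w. x \<in> L \<Longrightarrow> w \<in> W \<Longrightarrow> \<exists>n. (br x ^^ n) w \<in> U"
    "\<And>x y. x \<in> L \<Longrightarrow> y \<in> L \<Longrightarrow> \<exists>n. (br x ^^ n) y = 0"
  shows "\<exists>w\<in>W - U. \<forall>x\<in>L. br x w \<in> U"
  using assms
proof (induction "dim L" arbitrary: L U W rule: less_induct)
  case less
  note sU = less(3) and sW = less(4)
  have sL: "subspace L" and cL: "\<And>x y. x \<in> L \<Longrightarrow> y \<in> L \<Longrightarrow> br x y \<in> L"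
    using less(2) by (auto simp: lie_subalgebra_def)
  show ?case
  proof (cases "L = {0}")
    case True
    then show ?thesis using less(5) subspace_0[OF sU] by (auto simp: br_simps)
  next
    case False
    let ?P = "\<lambda>M. lie_subalgebra br M \<and> M \<subset> L"
    have "?P {0}" using False subspace_0[OF sL] by (auto simp: lie_subalgebra_def)
    moreover have "\<forall>M. ?P M \<longrightarrow> dim M < Suc (dim L)" by (simp add: dim_subset le_imp_less_Suc psubset_imp_subset)
    ultimately obtain M where M: "?P M" and max: "\<And>N. ?P N \<Longrightarrow> dim N \<le> dim M"
      using ex_has_greatest_nat[of ?P "{0}" dim "Suc (dim L)"] by blast
    have sM: "subspace M" and cM: "\<And>x y. x \<in> M \<Longrightarrow> y \<in> M \<Longrightarrow> br x y \<in> M" and subL: "M \<subseteq> L"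
      using M by (auto simp: lie_subalgebra_def)
    have dM: "dim M < dim L" using M dim_psubset sM sL by (metis span_eq_iff)
    have "\<exists>w\<in>L - M. \<forall>x\<in>M. br x w \<in> M"
    proof (rule less(1)[OF dM])
      show "\<exists>n. (br x ^^ n) w \<in> M" if "x \<in> M" "w \<in> L" for x w
        using less(9)[of x w] that subL subspace_0[OF sM] by (metis subsetD)
      show "\<exists>n. (br x ^^ n) y = 0" if "x \<in> M" "y \<in> M" for x y
        using less(9)[of x y] that subL by blast
    qed (use M sM sL cM cL subL in \<open>auto\<close>)
    then obtain v where v: "v \<in> L" "v \<notin> M" "\<And>x. x \<in> M \<Longrightarrow> br x v \<in> M" by blast
    define M' where "M' = {m + c *\<^sub>R v |m c. m \<in> M}"
    have "M' = {x + y |x y. x \<in> M \<and> y \<in> span {v}}"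
      unfolding M'_def span_singleton by blast
    then have sM': "subspace M'" using subspace_sums[OF sM subspace_span] by simp
    have vM: "br v m \<in> M" if "m \<in> M" for m
      using v(3)[OF that] br_anti[of v m] subspace_neg[OF sM] by (metis br_anti)
    have "lie_subalgebra br M'" unfolding lie_subalgebra_def
    proof (intro conjI sM' ballI)
      fix x y assume "x \<in> M'" "y \<in> M'"
      then obtain m c m' c' where eq: "x = m + c *\<^sub>R v" "y = m' + c' *\<^sub>R v" "m \<in> M" "m' \<in> M"
        unfolding M'_def by blast
      have "br x y = br m m' + c' *\<^sub>R br m v + c *\<^sub>R br v m'"
        by (simp add: eq br_simps)
      also have "\<dots> \<in> M" by (intro subspace_add[OF sM] subspace_scale[OF sM] cM eq v vM)
      finally have "br x y = br x y + 0 *\<^sub>R v \<and> br x y \<in> M" by simp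
      then show "br x y \<in> M'" unfolding M'_def by blast
    qed
    moreover have MM': "M \<subset> M'"
    proof -
      have "v \<in> M'" unfolding M'_def using subspace_0[OF sM] by (auto intro!: exI[of _ 0] exI[of _ 1])
      moreover have "m \<in> M'" if "m \<in> M" for m unfolding M'_def using that by (auto intro!: exI[of _ 0] exI[of _ m])
      ultimately show ?thesis using v by blast
    qed
    moreover have "M' \<subseteq> L" unfolding M'_def using subL v subspace_add[OF sL] subspace_scale[OF sL] by blast
    moreover have "dim M < dim M'" using MM' dim_psubset sM sM' by (metis span_eq_iff)
    ultimately have "M' = L" using max[of M'] by (metis not_less psubsetI)
    define W0 where "W0 = {w \<in> W. \<forall>x\<in>M. br x w \<in> U}"
    have "\<exists>w\<in>W - U. \<forall>x\<in>M. br x w \<in> U"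
    proof (rule less(1)[OF dM])
      show "\<exists>n. (br x ^^ n) w \<in> U" if "x \<in> M" "w \<in> W" for x w
        using less(8)[of x w] that subL by blast
      show "\<exists>n. (br x ^^ n) y = 0" if "x \<in> M" "y \<in> M" for x y
        using less(9)[of x y] that subL by blast
    qed (use M subL sU sW less(5-7) in \<open>auto\<close>)
    then obtain w0 where w0: "w0 \<in> W0" "w0 \<notin> U" by (auto simp: W0_def)
    have vW0: "br v w \<in> W0" if "w \<in> W0" for w
    proof -
      have "br m (br v w) \<in> U" if m: "m \<in> M" for m
      proof -
        have "br m (br v w) = br (br m v) w + br v (br m w)" by (rule br_jacobi)
        also have "\<dots> \<in> U"
          using \<open>w \<in> W0\<close> m v less(7) by (intro subspace_add[OF sU]) (auto simp: W0_def)
        finally show ?thesis .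
      qed
      then show ?thesis using that v less(6) by (auto simp: W0_def)
    qed
    have pw: "(br v ^^ n) w0 \<in> W0" for n by (induction n) (auto simp: w0 vW0)
    obtain n where n: "(br v ^^ n) w0 \<in> U" using less(8)[of v w0] v(1) w0(1) by (auto simp: W0_def)
    define k where "k = (LEAST n. (br v ^^ n) w0 \<in> U)"
    have k: "(br v ^^ k) w0 \<in> U" unfolding k_def using n by (rule LeastI)
    have "k \<noteq> 0" using k w0 by (cases k) auto
    then obtain j where j: "k = Suc j" by (cases k) auto
    have jn: "(br v ^^ j) w0 \<notin> U" using not_less_Least[of j "\<lambda>n. (br v ^^ n) w0 \<in> U"] j k_def by auto
    let ?w = "(br v ^^ j) w0"
    have "br x ?w \<in> U" if xL: "x \<in> L" for x
    proof -
      obtain m c where "x = m + c *\<^sub>R v" "m \<in> M" using xL \<open>M' = L\<close> M'_def by blast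
      then have "br x ?w = br m ?w + c *\<^sub>R br v ?w" by (simp add: br_simps)
      also have "\<dots> \<in> U" using pw[of j] \<open>m \<in> M\<close> k j
        by (intro subspace_add[OF sU] subspace_scale[OF sU]) (auto simp: W0_def)
      finally show ?thesis .
    qed
    then show ?thesis using pw[of j] jn by (auto simp: W0_def)
  qed
qed

lemma subspace_lower_central_series:
  "subspace H \<Longrightarrow> subspace (lower_central_series br H n)"
  by (cases n) (auto simp: lie_prod_def)

lemma nilpotent_imp_ad_nilpotent:
  assumes "nilpotent_subalgebra br H" "x \<in> H" "y \<in> H"
  shows "\<exists>n. (br x ^^ n) y = 0"
proof -
  have "(br x ^^ n) y \<in> lower_central_series br H n" for n
    by (induction n) (use assms in \<open>auto simp: lie_prod_def intro: span_base\<close>)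
  then show ?thesis using assms(1) unfolding nilpotent_subalgebra_def by (metis singletonD)
qed

primrec upper_central :: "'g set \<Rightarrow> nat \<Rightarrow> 'g set" where
  "upper_central C 0 = {0}"
| "upper_central C (Suc n) = {w \<in> C. \<forall>x\<in>C. br x w \<in> upper_central C n}"

text \<open>
Engel's theorem makes the upper central series grow strictly until it exhausts \<open>C\<close>; the lower
central series then descends through it.
\<close>
lemma ad_nilpotent_imp_nilpotent:
  assumes C: "lie_subalgebra br C" and nil: "\<And>x y. x \<in> C \<Longrightarrow> y \<in> C \<Longrightarrow> \<exists>n. (br x ^^ n) y = 0"
  shows "nilpotent_subalgebra br C"
proof -
  let ?Z = "upper_central C"
  have sC: "subspace C" and cC: "\<And>x y. x \<in> C \<Longrightarrow> y \<in> C \<Longrightarrow> br x y \<in> C"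
    using C by (auto simp: lie_subalgebra_def)
  have sZ: "subspace (?Z n)" for n
  proof (induction n)
    case (Suc n)
    then show ?case
      by (auto intro!: subspaceI subspace_0[OF sC] subspace_add[OF sC] subspace_scale[OF sC]
          subspace_0[OF Suc] subspace_add[OF Suc] subspace_scale[OF Suc] simp: br_simps)
  qed simp
  have ZC: "?Z n \<subseteq> C" for n using subspace_0[OF sC] by (cases n) auto
  have mono: "?Z n \<subseteq> ?Z (Suc n)" for n
  proof (induction n)
    case 0
    then show ?case using subspace_0[OF sC] by (auto simp: br_simps)
  qed auto
  have inv: "br x w \<in> ?Z n" if "x \<in> C" "w \<in> ?Z n" for x w n
    using mono[of n] that by auto
  have grow: "n \<le> dim (?Z n) \<or> ?Z n = C" for n
  proof (induction n)
    case (Suc n)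
    show ?case
    proof (cases "?Z n = C")
      case True
      then show ?thesis using mono ZC by blast
    next
      case False
      then have sub: "?Z n \<subset> C" using ZC by blast
      have "\<exists>w\<in>C - ?Z n. \<forall>x\<in>C. br x w \<in> ?Z n"
      proof (rule engel[OF C sZ sC sub cC inv])
        show "\<exists>m. (br x ^^ m) w \<in> ?Z n" if "x \<in> C" "w \<in> C" for x w
          using nil[OF that] subspace_0[OF sZ[of n]] by metis
      qed (use nil in auto)
      then have "?Z n \<subset> ?Z (Suc n)" using mono[of n] by auto
      then have "dim (?Z n) < dim (?Z (Suc n))" using dim_psubset sZ by (metis span_eq_iff)
      then show ?thesis using Suc False by auto
    qed
  qed simp
  define m where "m = Suc DIM('g)"
  have "?Z m = C" using grow[of m] dim_subset_UNIV[of "?Z m"] by (auto simp: m_def)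
  have "lower_central_series br C k \<subseteq> ?Z (m - k)" if "k \<le> m" for k
    using that
  proof (induction k)
    case 0
    then show ?case using \<open>?Z m = C\<close> by simp
  next
    case (Suc k)
    then have "m - k = Suc (m - Suc k)" by simp
    then have "br x y \<in> ?Z (m - Suc k)" if "x \<in> C" "y \<in> lower_central_series br C k" for x y
      using Suc that by auto
    then show ?case unfolding lower_central_series.simps lie_prod_def
      by (intro span_minimal sZ) auto
  qed
  from this[of m] have "lower_central_series br C m \<subseteq> {0}" by simp
  then have "lower_central_series br C m = {0}"
    using subspace_0[OF subspace_lower_central_series[OF sC]] by blast
  then show ?thesis using C by (auto simp: nilpotent_subalgebra_def)
qed

text \<open>
Engel's theorem would give a nonzero central element, but the centre of a simple Lie algebra is zero.
\<close>
lemma simple_not_ad_nilpotent: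
  assumes "simple_lie_algebra br" "\<And>x y. \<exists>n. (br x ^^ n) y = 0"
  shows False
proof -
  obtain x0 y0 where xy: "br x0 y0 \<noteq> 0" using assms(1) by (auto simp: simple_lie_algebra_def)
  have "\<exists>w\<in>UNIV - {0}. \<forall>x\<in>UNIV. br x w \<in> {0}"
  proof (rule engel[OF lie_subalgebra_UNIV])
    show "{0} \<subset> (UNIV :: 'g set)" using xy by auto
  qed (use assms(2) in \<open>auto simp: br_simps\<close>)
  then obtain w where w: "w \<noteq> 0" "\<And>x. br x w = 0" by auto
  have "lie_ideal br {w. \<forall>x. br x w = 0}"
    by (auto simp: lie_ideal_def br_simps intro!: subspaceI)
  then have "{w. \<forall>x. br x w = 0} = UNIV"
    using assms(1) w unfolding simple_lie_algebra_def by blast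
  then show False using xy by blast
qed

section \<open>Derivations and the Killing form\<close>

definition derivation :: "('g \<Rightarrow> 'g) \<Rightarrow> bool" where
  "derivation D \<longleftrightarrow> linear D \<and> (\<forall>x y. D (br x y) = br (D x) y + br x (D y))"

definition killing :: "'g \<Rightarrow> 'g \<Rightarrow> real" where
  "killing x y = tr (\<lambda>v. br x (br y v))"

lemma linear_killing: "linear (killing x)" and linear_killing_left: "linear (\<lambda>x. killing x y)"
  by (rule linearI; simp add: killing_def br_simps tr_add tr_scale)+

lemma killing_commute: "killing x y = killing y x"
  unfolding killing_def by (rule tr_commute[OF linear_br linear_br])

lemma tr_commutator:
  assumes "linear T"
  shows "tr (\<lambda>v. br (br a b) (T v)) = tr (\<lambda>v. br a (br b (T v) - T (br b v)))"
proof -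
  have "tr (\<lambda>v. br (br a b) (T v)) = tr (\<lambda>v. br a (br b (T v))) - tr (\<lambda>v. br b (br a (T v)))"
    by (simp add: br_br tr_diff)
  also have "tr (\<lambda>v. br b (br a (T v))) = tr (\<lambda>v. br a (T (br b v)))"
    using tr_commute[OF linear_br, of "\<lambda>v. br a (T v)" b] linear_compose[OF assms linear_br, of a]
    by (simp add: o_def)
  finally show ?thesis by (simp add: br_simps tr_diff)
qed

text \<open>
For \<open>T\<close> a derivation the commutator \<open>[ad b, T]\<close> is \<open>- ad (T b)\<close>, so a trace against a
commutator becomes a value of the Killing form.
\<close>
lemma tr_commutator_derivation:
  assumes "derivation D"
  shows "tr (\<lambda>v. br (br a b) (D v)) = - killing a (D b)"
proof -
  have "br b (D v) - D (br b v) = - br (D b) v" for v using assms by (simp add: derivation_def)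
  then show ?thesis using tr_commutator[of D a b] assms
    by (simp add: derivation_def killing_def br_simps tr_scale[of "-1", simplified])
qed

lemma killing_invariant: "killing (br x y) z = killing x (br y z)"
  unfolding killing_def tr_commutator[OF linear_br] by (simp only: br_br)

text \<open>
A nondegenerate form represents every linear functional; the inner product of the Euclidean space
serves as the reference form.
\<close>
lemma killing_riesz:
  assumes nd: "\<And>x. (\<And>y. killing x y = 0) \<Longrightarrow> x = 0" and lint: "linear t"
  obtains z where "\<And>y. killing z y = t y"
proof -
  have rep: "(\<Sum>b\<in>Basis. s b *\<^sub>R b) \<bullet> y = s y" if lin: "linear s" for s :: "'g \<Rightarrow> real" and y
  proof -
    have "s y = s (\<Sum>b\<in>Basis. (y \<bullet> b) *\<^sub>R b)" by (simp add: euclidean_representation)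
    then show ?thesis
      by (simp add: inner_sum_left linear_sum[OF lin] linear_cmul[OF lin] inner_commute[of y] mult.commute)
  qed
  define K where "K x = (\<Sum>b\<in>Basis. killing x b *\<^sub>R b)" for x
  have K: "K x \<bullet> y = killing x y" for x y
    unfolding K_def by (rule rep[OF linear_killing])
  have linK: "linear K"
    by (rule linearI) (auto simp: K_def linear_add[OF linear_killing_left] linear_cmul[OF linear_killing_left]
        algebra_simps sum.distrib scaleR_right.sum)
  have "inj K"
  proof (rule linear_injective_0[OF linK, THEN iffD2], intro allI impI)
    fix x assume "K x = 0" then show "x = 0" using nd[of x] K[of x] by simp
  qed
  then have "surj K" using linear_injective_imp_surjective[OF linK] by blast
  then obtain z where "K z = (\<Sum>b\<in>Basis. t b *\<^sub>R b)" by (metis surjD)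
  then have "killing z y = t y" for y using K[of z y] rep[OF lint, of y] by simp
  then show ?thesis using that by blast
qed

text \<open>
Choose \<open>z\<close> such that \<open>F = D - ad z\<close> is trace-orthogonal to all \<open>ad x\<close>. As \<open>F\<close> is a derivation,
\<open>killing a (F b)\<close> is a trace of \<open>F\<close> against \<open>ad (br a b)\<close>, hence zero, and \<open>F = 0\<close> by
nondegeneracy.
\<close>
lemma derivation_inner:
  assumes nd: "\<And>x. (\<And>y. killing x y = 0) \<Longrightarrow> x = 0" and D: "derivation D"
  obtains z where "\<And>x. D x = br z x"
proof -
  have linD: "linear D" using D by (simp add: derivation_def)
  define t where "t x = tr (\<lambda>v. D (br x v))" for x
  have lint: "linear t"
    by (rule linearI) (simp_all add: t_def br_simps linear_add[OF linD] linear_cmul[OF linD] tr_add tr_scale)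
  obtain z where zt: "\<And>y. killing z y = t y" by (rule killing_riesz[OF nd lint]) blast+
  define F where "F v = D v - br z v" for v
  have linF: "linear F" unfolding F_def using linD linear_br by (rule linear_compose_sub)
  have derF: "F (br x y) = br (F x) y + br x (F y)" for x y
    using D br_jacobi[of z x y] by (simp add: F_def derivation_def br_simps)
  have "derivation F" using linF derF by (simp add: derivation_def)
  have trF: "tr (\<lambda>v. F (br x v)) = 0" for x
    using zt[of x] by (simp add: F_def tr_diff t_def killing_def)
  have "F b = 0" for b
  proof (rule nd)
    fix a
    have "killing a (F b) = - tr (\<lambda>v. br (br a b) (F v))"
      using tr_commutator_derivation[OF \<open>derivation F\<close>, of a b] by simp
    also have "\<dots> = - tr (\<lambda>v. F (br (br a b) v))" using tr_commute[OF linear_br linF] by simp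
    finally show "killing (F b) a = 0" by (simp add: trF killing_commute)
  qed
  then show ?thesis using that[of z] by (simp add: F_def)
qed

text \<open>
With \<open>A = ad x - \<lambda>\<close>, \<open>B = ad x - \<mu>\<close> and \<open>C = ad x - (\<lambda> + \<mu>)\<close> this says that the bracket adds
generalised eigenvalues; with \<open>A = B = C\<close> it says that the generalised null space of a derivation
is closed under the bracket.
\<close>
lemma weighted_leibniz:
  assumes lin: "linear A" "linear B" "linear C" and C: "\<And>u v. C (br u v) = br (A u) v + br u (B v)"
    and "u \<in> nilspace A" "v \<in> nilspace B"
  shows "br u v \<in> nilspace C"
proof -
  have "(C ^^ (m + n)) (br u v) = 0" if "(A ^^ m) u = 0" "(B ^^ n) v = 0" for m n
    using that
  proof (induction "m + n" arbitrary: m n u v)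
    case 0
    then show ?case by (simp add: br_simps)
  next
    case (Suc k)
    have lC: "linear (C ^^ k)" by (rule linear_funpow[OF lin(3)])
    have e1: "(C ^^ k) (br (A u) v) = 0"
    proof (cases m)
      case 0
      then have "u = 0" using Suc by simp
      then show ?thesis by (simp add: br_simps linear_0[OF lin(1)] linear_0[OF lC])
    next
      case m: (Suc m')
      have "(A ^^ m') (A u) = 0" using Suc.prems(1) m by (simp add: funpow_swap1)
      then show ?thesis using Suc(1)[of m' n "A u" v] Suc m by simp
    qed
    have e2: "(C ^^ k) (br u (B v)) = 0"
    proof (cases n)
      case 0
      then have "v = 0" using Suc by simp
      then show ?thesis by (simp add: br_simps linear_0[OF lin(2)] linear_0[OF lC])
    next
      case n: (Suc n')
      have "(B ^^ n') (B v) = 0" using Suc.prems(2) n by (simp add: funpow_swap1)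
      then show ?thesis using Suc(1)[of m n' u "B v"] Suc n by simp
    qed
    have "(C ^^ Suc k) (br u v) = (C ^^ k) (C (br u v))" by (simp add: funpow_swap1)
    also have "\<dots> = 0" by (simp add: C linear_add[OF lC] e1 e2)
    finally show ?case using Suc(2) by simp
  qed
  then show ?thesis using assms(5,6) unfolding nilspace_def by blast
qed

end

section \<open>Cartan's criterion\<close>

locale complex_lie_alg = lie_alg br + complex_structure J for br :: "'g::euclidean_space \<Rightarrow> 'g \<Rightarrow> 'g"
    and J :: "'g \<Rightarrow> 'g" +
  assumes br_J: "br (J x) y = J (br x y)"
begin

lemma br_J_right: "br x (J y) = J (br x y)"
  using br_J[of y x] by (metis br_anti linear_neg linear_J)

lemma br_cscale: "br (z \<bullet>\<^sub>J x) y = z \<bullet>\<^sub>J br x y" "br x (z \<bullet>\<^sub>J y) = z \<bullet>\<^sub>J br x y"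
  by (simp_all add: cscale_def br_simps br_J br_J_right)

text \<open>
Let \<open>Y\<close> be multiplication by the conjugate of \<open>z\<close> on the generalised \<open>z\<close>-eigenspace of \<open>ad x\<close>.
It is a derivation because the bracket adds eigenvalues, so vanishing of the Killing form and
\<open>tr_commutator_derivation\<close> give \<open>tr (ad x \<circ> Y) = 0\<close>. On the other hand
\<open>ad x \<circ> Y\<close> is \<open>|z|^2\<close> plus a nilpotent operator on that eigenspace. Hence zero is the only
eigenvalue. All traces are traces of real operators.
\<close>
lemma cartan_criterion:
  assumes kill: "\<And>x y. killing x y = 0" and x: "x \<in> span {br a b |a b. True}"
  shows "(br x ^^ DIM('g)) v = 0"
proof -
  interpret complex_operator J "br x"
    by unfold_locales (simp_all add: br_simps br_J_right)
  obtain L E where L: "finite L" and E: "\<And>z. linear (E z)" "\<And>z v. E z (J v) = J (E z v)"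
      "\<And>z v. E z (br x v) = br x (E z v)"
    and sumE: "\<And>v. v = (\<Sum>z\<in>L. E z v)"
    and nilE: "\<And>z v. E z v \<in> nilspace (shifted z)" and idE: "\<And>z v. E z (E z v) = E z v"
    and E0: "\<And>z u v. v \<in> nilspace (shifted z) \<Longrightarrow> z \<noteq> u \<Longrightarrow> E u v = 0"
    and E1: "\<And>z v. v \<in> nilspace (shifted z) \<Longrightarrow> E z v = v" and Eout: "\<And>z v. z \<notin> L \<Longrightarrow> E z v = 0"
    by (rule spectral_family) blast
  define Y where "Y v = (\<Sum>z\<in>L. cnj z \<bullet>\<^sub>J E z v)" for v
  have linY: "linear Y" unfolding Y_def
    by (intro linear_compose_sum ballI linear_compose[OF E(1) linear_cscale, unfolded o_def])
  have Yv: "Y v = cnj z \<bullet>\<^sub>J v" if "v \<in> nilspace (shifted z)" for z v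
  proof -
    have "Y v = (\<Sum>u\<in>L. if u = z then cnj z \<bullet>\<^sub>J v else 0)" unfolding Y_def
      by (rule sum.cong) (use E0[OF that] E1[OF that] in \<open>auto simp: cscale_simps\<close>)
    also have "\<dots> = cnj z \<bullet>\<^sub>J v" using L E1[OF that] Eout[of z v] by (auto simp: cscale_simps)
    finally show ?thesis .
  qed
  have brN: "br u v \<in> nilspace (shifted (z + w))" if "u \<in> nilspace (shifted z)" "v \<in> nilspace (shifted w)" for u v z w
  proof (rule weighted_leibniz[OF linear_shifted linear_shifted linear_shifted _ that])
    fix u v show "shifted (z + w) (br u v) = br (shifted z u) v + br u (shifted w v)"
      by (simp add: shifted_def br_simps br_cscale cscale_simps br_jacobi[of x u v])
  qed
  have derE: "Y (br (E z u) (E w v)) = br (Y (E z u)) (E w v) + br (E z u) (Y (E w v))" for u v z w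
    by (simp add: Yv[OF brN[OF nilE nilE]] Yv[OF nilE] br_cscale cscale_simps)
  have lin_sumL: "br (\<Sum>z\<in>L. f z) y = (\<Sum>z\<in>L. br (f z) y)" for f y
    using linear_sum[OF linear_br_left] .
  have "Y (br u v) = br (Y u) v + br u (Y v)" for u v
  proof -
    have "br p q = (\<Sum>z\<in>L. \<Sum>w\<in>L. br (E z p) (E w q))" for p q
    proof -
      have "br p q = (\<Sum>w\<in>L. \<Sum>z\<in>L. br (E z p) (E w q))"
        by (subst sumE[of p], subst sumE[of q]) (simp add: lin_sumL linear_sum[OF linear_br])
      also have "\<dots> = (\<Sum>z\<in>L. \<Sum>w\<in>L. br (E z p) (E w q))" by (rule sum.swap)
      finally show ?thesis .
    qed
    have YE: "Y (E z u) = E z (Y u)" for z u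
    proof -
      have "E z (Y u) = (\<Sum>w\<in>L. cnj w \<bullet>\<^sub>J E z (E w u))"
        by (simp add: Y_def linear_sum[OF E(1)] commute_cscale[OF E(1,2)])
      also have "\<dots> = (\<Sum>w\<in>L. if w = z then cnj z \<bullet>\<^sub>J E z u else 0)"
        by (rule sum.cong) (use E0[OF nilE] in \<open>auto simp: idE cscale_simps\<close>)
      also have "\<dots> = cnj z \<bullet>\<^sub>J E z u" using L Eout[of z u] by (auto simp: cscale_simps)
      finally show ?thesis using Yv[OF nilE] by simp
    qed
    have "Y (br u v) = (\<Sum>z\<in>L. \<Sum>w\<in>L. Y (br (E z u) (E w v)))"
      by (subst \<open>\<And>q p. br p q = (\<Sum>z\<in>L. \<Sum>w\<in>L. br (E z p) (E w q))\<close>) (simp add: linear_sum[OF linY])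
    also have "\<dots> = (\<Sum>z\<in>L. \<Sum>w\<in>L. br (E z (Y u)) (E w v)) + (\<Sum>z\<in>L. \<Sum>w\<in>L. br (E z u) (E w (Y v)))"
      by (simp add: derE YE sum.distrib)
    also have "\<dots> = br (Y u) v + br u (Y v)"
      using \<open>\<And>q p. br p q = (\<Sum>z\<in>L. \<Sum>w\<in>L. br (E z p) (E w q))\<close> by metis
    finally show ?thesis .
  qed
  then have derY: "derivation Y" using linY by (simp add: derivation_def)
  have "tr (\<lambda>v. br x (Y v)) = 0"
    using x
  proof (induction rule: span_induct_alt)
    case base
    then show ?case by (simp add: br_simps tr_zero)
  next
    case (step c y w)
    then obtain a b where "y = br a b" by blast
    then have "tr (\<lambda>v. br y (Y v)) = 0" using tr_commutator_derivation[OF derY] kill by simp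
    then show ?case using step by (simp add: br_simps tr_add tr_scale)
  qed
  moreover have "tr (\<lambda>v. br x (Y v)) = (\<Sum>z\<in>L. (cmod z)\<^sup>2 * tr (E z))"
  proof -
    have "tr (\<lambda>v. br x (cnj z \<bullet>\<^sub>J E z v)) = (cmod z)\<^sup>2 * tr (E z)" for z
    proof -
      \<comment> \<open>The deviation of \<open>ad x \<circ> Y\<close> from a scalar on the range of \<open>E z\<close>; it is nilpotent.\<close>
      define T where "T v = cnj z \<bullet>\<^sub>J shifted z (E z v)" for v
      have linT: "linear T" unfolding T_def
        using linear_compose[OF linear_compose[OF E(1) linear_shifted] linear_cscale] by (simp add: o_def)
      have ET: "E z (T v) = T v" for v
        by (simp add: T_def commute_cscale[OF E(1,2)] commute_shifted[OF E(1,2,3)] idE)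
      have sh: "shifted z (c \<bullet>\<^sub>J w) = c \<bullet>\<^sub>J shifted z w" for c w
        unfolding shifted_def br_cscale(2) cscale_simps(3,4) mult.commute[of z c] ..
      have "(T ^^ n) (E z v) = cnj z ^ n \<bullet>\<^sub>J (shifted z ^^ n) (E z v)" for n v
      proof (induction n)
        case (Suc n)
        have "E z ((T ^^ n) (E z v)) = (T ^^ n) (E z v)"
          by (cases n) (auto simp: ET idE)
        then have "(T ^^ Suc n) (E z v) = cnj z \<bullet>\<^sub>J shifted z ((T ^^ n) (E z v))" by (simp add: T_def)
        also have "\<dots> = cnj z ^ Suc n \<bullet>\<^sub>J (shifted z ^^ Suc n) (E z v)"
          unfolding Suc sh by (simp add: cscale_simps)
        finally show ?case .
      qed (simp add: cscale_simps)
      then have "(T ^^ DIM('g)) (E z v) = 0" for v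
        using nilE[of z v] by (simp add: nilspace_eq[OF linear_shifted] cscale_simps)
      moreover have "T (E z v) = T v" for v by (simp add: T_def idE)
      ultimately have "(T ^^ Suc DIM('g)) v = 0" for v
        by (metis ET comp_apply funpow_Suc_right)
      then have "tr T = 0" using tr_nilpotent[OF linT] by blast
      moreover have "br x (cnj z \<bullet>\<^sub>J E z v) = T v + (cmod z)\<^sup>2 *\<^sub>R E z v" for v
      proof -
        have "br x (E z v) = shifted z (E z v) + z \<bullet>\<^sub>J E z v" by (simp add: shifted_def)
        then have "br x (cnj z \<bullet>\<^sub>J E z v) = T v + (cnj z * z) \<bullet>\<^sub>J E z v"
          by (simp add: br_cscale T_def cscale_simps)
        also have "cnj z * z = of_real ((cmod z)\<^sup>2)"
          by (simp only: mult.commute[of "cnj z"] complex_norm_square)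
        finally show ?thesis by (simp only: cscale_of_real)
      qed
      ultimately show ?thesis by (simp add: tr_add tr_scale)
    qed
    then show ?thesis by (simp add: Y_def linear_sum[OF linear_br] tr_sum)
  qed
  ultimately have s0: "(\<Sum>z\<in>L. (cmod z)\<^sup>2 * tr (E z)) = 0" by simp
  have tr_ge: "tr (E z) \<ge> 0" and tr_pos: "E z w \<noteq> 0 \<Longrightarrow> tr (E z) > 0" for z w
  proof -
    show "tr (E z) > 0" if "E z w \<noteq> 0" for w using tr_idempotent_pos[OF E(1) idE that] .
    then show "tr (E z) \<ge> 0" by (cases "\<exists>w. E z w \<noteq> 0") (auto simp: tr_def less_imp_le)
  qed
  have z0: "(cmod z)\<^sup>2 * tr (E z) = 0" if "z \<in> L" for z
    using s0 sum_nonneg_eq_0_iff[OF L, of "\<lambda>z. (cmod z)\<^sup>2 * tr (E z)"] tr_ge that by simp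
  have "E z v = 0" if "z \<noteq> 0" for z
    using z0[of z] tr_pos[of z v] Eout[of z v] that by (cases "z \<in> L") auto
  then have "v = (\<Sum>z\<in>L. if z = 0 then E 0 v else 0)"
    by (subst sumE) (rule sum.cong, auto)
  also have "\<dots> = E 0 v" using L Eout[of 0 v] by auto
  finally have "v \<in> nilspace (shifted 0)" using nilE[of 0 v] by simp
  moreover have "shifted 0 = br x" by (auto simp: shifted_def cscale_simps)
  ultimately show ?thesis using nilspace_eq[OF linear_br] by simp
qed

end

context lie_alg
begin

definition br_cplx :: "'g \<times> 'g \<Rightarrow> 'g \<times> 'g \<Rightarrow> 'g \<times> 'g" where
  "br_cplx p q = (br (fst p) (fst q) - br (snd p) (snd q), br (fst p) (snd q) + br (snd p) (fst q))"

definition J_cplx :: "'g \<times> 'g \<Rightarrow> 'g \<times> 'g" where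
  "J_cplx p = (- snd p, fst p)"

lemma complexification: "complex_lie_alg br_cplx J_cplx"
proof (intro complex_lie_alg.intro lie_alg.intro complex_structure.intro complex_lie_alg_axioms.intro)
  show "lie_algebra br_cplx" unfolding lie_algebra_def
  proof (intro conjI allI)
    show "bilinear br_cplx" unfolding bilinear_def
      by (auto intro!: linearI simp: br_cplx_def br_simps algebra_simps)
    show "br_cplx p p = 0" for p
      using br_anti[of "fst p" "snd p"] by (simp add: br_cplx_def zero_prod_def)
    fix p q r :: "'g \<times> 'g"
    let ?j = "\<lambda>x y z. br x (br y z) + br y (br z x) + br z (br x y)"
    obtain a b c d e f where [simp]: "p = (a, b)" "q = (c, d)" "r = (e, f)" by (meson surj_pair)
    have "br_cplx p (br_cplx q r) + br_cplx q (br_cplx r p) + br_cplx r (br_cplx p q) =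
      (?j a c e - ?j a d f - ?j b c f - ?j b d e, ?j a c f + ?j a d e + ?j b c e - ?j b d f)"
      by (simp add: br_cplx_def br_simps algebra_simps)
    then show "br_cplx p (br_cplx q r) + br_cplx q (br_cplx r p) + br_cplx r (br_cplx p q) = 0"
      unfolding br_jacobi_sum by (simp add: zero_prod_def)
  qed
  show "linear J_cplx" by (auto intro!: linearI simp: J_cplx_def)
  show "J_cplx (J_cplx v) = - v" for v by (simp add: J_cplx_def prod_eq_iff)
  show "br_cplx (J_cplx x) y = J_cplx (br_cplx x y)" for x y
    by (simp add: br_cplx_def J_cplx_def br_simps)
qed

lemma simple_perfect:
  assumes "simple_lie_algebra br"
  shows "span {br a b |a b. True} = UNIV"
proof -
  let ?I = "span {br a b |a b. True}"
  obtain x0 y0 where xy: "br x0 y0 \<noteq> 0" using assms by (auto simp: simple_lie_algebra_def)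
  have "lie_ideal br ?I" by (auto simp: lie_ideal_def intro: span_base)
  moreover have "br x0 y0 \<in> ?I" by (auto intro: span_base)
  ultimately show ?thesis using assms xy unfolding simple_lie_algebra_def by blast
qed

text \<open>
The radical of the Killing form is an ideal. Were it everything, the Killing form of the
complexification would vanish too (its real trace is twice the real part of the complex one), and
the criterion would make every \<open>ad x\<close> nilpotent, since a simple Lie algebra is spanned by brackets.
\<close>
lemma killing_nondegenerate:
  assumes simple: "simple_lie_algebra br" and x: "\<And>y. killing x y = 0"
  shows "x = 0"
proof -
  let ?R = "{x. \<forall>y. killing x y = 0}"
  have "lie_ideal br ?R" unfolding lie_ideal_def
  proof (intro conjI allI ballI)
    show "subspace ?R" by (auto intro!: subspaceI simp: linear_add[OF linear_killing_left]
      linear_cmul[OF linear_killing_left] linear_0[OF linear_killing_left])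
    fix a b assume b: "b \<in> ?R"
    have "killing (br a b) y = - killing b (br a y)" for y
      using killing_invariant[of b a y] br_anti[of a b] linear_neg[OF linear_killing_left] by (metis br_anti minus_minus)
    then show "br a b \<in> ?R" using b by simp
  qed
  then consider "?R = {0}" | "?R = UNIV" using simple unfolding simple_lie_algebra_def by blast
  then show ?thesis
  proof cases
    case 1
    then show ?thesis using x by blast
  next
    case 2
    then have kill: "killing x y = 0" for x y by blast
    interpret c: complex_lie_alg br_cplx J_cplx by (rule complexification)
    have ckill: "c.killing p q = 0" for p q
    proof -
      have "c.killing p q = (killing (fst p) (fst q) - killing (snd p) (snd q))
          + (killing (fst p) (fst q) - killing (snd p) (snd q))"
        unfolding c.killing_def tr_prod killing_def
        by (simp add: br_cplx_def br_simps tr_diff)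
      then show ?thesis by (simp add: kill)
    qed
    have "(x, 0) \<in> span {br_cplx a b |a b. True}" for x
    proof -
      have "x \<in> span {br a b |a b. True}" using simple_perfect[OF simple] by simp
      then show ?thesis
      proof (induction rule: span_induct_alt)
        case base
        then show ?case by (simp only: zero_prod_def[symmetric] span_zero)
      next
        case (step c y w)
        then obtain a b where "y = br a b" by blast
        then have "(y, 0) = br_cplx (a, 0) (b, 0)" by (simp add: br_cplx_def br_simps)
        then have "(y, 0) \<in> {br_cplx a b |a b. True}" by blast
        then have "(y, 0) \<in> span {br_cplx a b |a b. True}" by (rule span_base)
        from span_add[OF span_scale[OF this, of c] step(2)] show ?case by simp
      qed
    qed
    then have "(br_cplx (x, 0) ^^ DIM('g \<times> 'g)) (y, 0) = 0" for x y
      using c.cartan_criterion[OF ckill] by blast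
    moreover have "(br_cplx (x, 0) ^^ n) (y, 0) = ((br x ^^ n) y, 0)" for x y n
      by (induction n) (auto simp: br_cplx_def br_simps)
    ultimately have "(br x ^^ DIM('g \<times> 'g)) y = 0" for x y by (metis fst_conv fst_zero)
    then have "\<exists>n. (br x ^^ n) y = 0" for x y by blast
    then show ?thesis using simple_not_ad_nilpotent[OF simple] by blast
  qed
qed

end

section \<open>Polynomial curves\<close>

text \<open>
Genericity arguments are carried out along a line, where a nonzero polynomial has only finitely
many roots.
\<close>
lemma real_polynomial_finite_roots:
  fixes p :: "real \<Rightarrow> real"
  assumes "real_polynomial_function p" "p s \<noteq> 0"
  shows "finite {t. p t = 0}"
proof -
  obtain a n where p: "p = (\<lambda>x. \<Sum>i\<le>n. a i * x ^ i)"
    using assms(1) real_polynomial_function_iff_sum by blast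
  have "\<exists>i\<le>n. a i \<noteq> 0"
  proof (rule ccontr)
    assume "\<not> ?thesis"
    then have "p s = 0" unfolding p by (intro sum.neutral) auto
    then show False using assms(2) by simp
  qed
  then show ?thesis unfolding p using polyfun_finite_roots[where c = a and n = n] by simp
qed

lemma polynomial_curve_inner:
  fixes c :: "real \<Rightarrow> 'a::euclidean_space"
  assumes "polynomial_function c"
  shows "real_polynomial_function (\<lambda>t. c t \<bullet> w)"
  using assms bounded_linear_inner_left[of w] unfolding polynomial_function_def o_def by blast

lemma polynomial_curve_zero:
  fixes c :: "real \<Rightarrow> 'a::euclidean_space"
  assumes "polynomial_function c" "infinite {t. c t = 0}"
  shows "c s = 0"
proof (rule ccontr)
  assume s: "c s \<noteq> 0"
  have "finite {t. c t \<bullet> c s = 0}"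
    using real_polynomial_finite_roots[OF polynomial_curve_inner[OF assms(1)], of s] s by simp
  then show False using assms(2) by (metis (mono_tags, lifting) Collect_mono finite_subset inner_zero_left)
qed

text \<open>
Gaussian elimination over the ring of polynomials: the curve \<open>v k\<close> is used as the pivot, with
pivot entry its component \<open>p\<close> in the direction \<open>v k s\<close>, which does not vanish at \<open>s\<close> and so vanishes
only finitely often.
\<close>
lemma independent_polynomial_curves:
  fixes v :: "'i \<Rightarrow> real \<Rightarrow> 'a::euclidean_space"
  assumes "finite I" "\<And>i. i \<in> I \<Longrightarrow> polynomial_function (v i)"
    "\<And>c. (\<Sum>i\<in>I. c i *\<^sub>R v i s) = 0 \<Longrightarrow> \<forall>i\<in>I. c i = 0"
  shows "finite {t. \<exists>c. (\<Sum>i\<in>I. c i *\<^sub>R v i t) = 0 \<and> (\<exists>i\<in>I. c i \<noteq> 0)}"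
  using assms
proof (induction I arbitrary: v rule: finite_induct)
  case (insert k F)
  define p where "p t = v k t \<bullet> v k s" for t
  define u where "u i t = p t *\<^sub>R v i t - (v i t \<bullet> v k s) *\<^sub>R v k t" for i t
  have "v k s \<noteq> 0"
  proof
    assume "v k s = 0"
    then have "(\<Sum>i\<in>insert k F. (if i = k then 1 else 0) *\<^sub>R v i s) = 0"
      by (intro sum.neutral) auto
    from insert(5)[OF this] show False by auto
  qed
  then have ps: "p s \<noteq> 0" by (simp add: p_def)
  have pol: "real_polynomial_function p"
    unfolding p_def using insert(4)[of k] by (intro polynomial_curve_inner) auto
  have sumu: "(\<Sum>i\<in>F. c i *\<^sub>R u i t) = p t *\<^sub>R (\<Sum>i\<in>F. c i *\<^sub>R v i t) - ((\<Sum>i\<in>F. c i *\<^sub>R v i t) \<bullet> v k s) *\<^sub>R v k t" for c t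
    by (simp add: u_def scaleR_diff_right sum_subtractf scaleR_sum_right inner_sum_left scaleR_sum_left mult.commute)
  let ?bad = "{t. \<exists>c. (\<Sum>i\<in>F. c i *\<^sub>R u i t) = 0 \<and> (\<exists>i\<in>F. c i \<noteq> 0)}"
  have "finite ?bad"
  proof (rule insert(3))
    show "polynomial_function (u i)" if "i \<in> F" for i
      unfolding u_def using insert(4)[of i] insert(4)[of k] that pol
      by (intro polynomial_function_diff polynomial_function_mult)
        (auto simp: real_polynomial_function_eq[symmetric] intro: polynomial_curve_inner)
    show "\<forall>i\<in>F. c i = 0" if c: "(\<Sum>i\<in>F. c i *\<^sub>R u i s) = 0" for c
    proof -
      \<comment> \<open>A relation between the eliminated curves, rewritten as a relation between the original ones.\<close>
      define d where "d i = (if i = k then - ((\<Sum>i\<in>F. c i *\<^sub>R v i s) \<bullet> v k s) else p s * c i)" for i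
      have "(\<Sum>i\<in>F. d i *\<^sub>R v i s) = (\<Sum>i\<in>F. (p s * c i) *\<^sub>R v i s)"
        by (rule sum.cong) (use insert(2) in \<open>auto simp: d_def\<close>)
      then have "(\<Sum>i\<in>insert k F. d i *\<^sub>R v i s) = (\<Sum>i\<in>F. c i *\<^sub>R u i s)"
        unfolding sumu using insert(1,2) by (simp add: d_def scaleR_sum_right)
      then have "\<forall>i\<in>insert k F. d i = 0" using insert(5) c by metis
      then show ?thesis using ps insert(2) by (auto simp: d_def split: if_splits)
    qed
  qed
  moreover have "finite {t. p t = 0}" by (rule real_polynomial_finite_roots[OF pol ps])
  moreover have "{t. \<exists>c. (\<Sum>i\<in>insert k F. c i *\<^sub>R v i t) = 0 \<and> (\<exists>i\<in>insert k F. c i \<noteq> 0)} \<subseteq> ?bad \<union> {t. p t = 0}"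
  proof (rule subsetI, rule ccontr)
    fix t assume "t \<in> {t. \<exists>c. (\<Sum>i\<in>insert k F. c i *\<^sub>R v i t) = 0 \<and> (\<exists>i\<in>insert k F. c i \<noteq> 0)}"
    then obtain c where c: "(\<Sum>i\<in>insert k F. c i *\<^sub>R v i t) = 0" "\<exists>i\<in>insert k F. c i \<noteq> 0" by blast
    assume "t \<notin> ?bad \<union> {t. p t = 0}"
    then have t: "t \<notin> ?bad" "p t \<noteq> 0" by auto
    have "(\<Sum>i\<in>F. c i *\<^sub>R v i t) = - (c k *\<^sub>R v k t)"
      using c(1) insert(1,2) by (simp add: eq_neg_iff_add_eq_0 add.commute)
    then have "(\<Sum>i\<in>F. c i *\<^sub>R u i t) = 0"
      unfolding sumu by (simp add: p_def[symmetric] mult.commute)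
    then have F0: "\<forall>i\<in>F. c i = 0" using t(1) by blast
    then have "(\<Sum>i\<in>F. c i *\<^sub>R v i t) = 0" by simp
    then have "c k *\<^sub>R v k t = 0" using c(1) insert(1,2) by simp
    moreover have "v k t \<noteq> 0" using t(2) by (auto simp: p_def)
    ultimately show False using c(2) F0 by auto
  qed
  ultimately show ?case by (meson finite_UnI finite_subset)
qed simp

section \<open>Existence of Cartan subalgebras and regular elements\<close>

context lie_alg
begin

lemma polynomial_curve_br:
  assumes "polynomial_function c"
  shows "polynomial_function (\<lambda>t::real. br (a + t *\<^sub>R b) (c t))"
proof -
  have lin: "polynomial_function (\<lambda>t. br x (c t))" for x
    using polynomial_function_compose[OF assms polynomial_function_bounded_linear, of "br x"]
      linear_conv_bounded_linear[of "br x"] linear_br by (simp add: o_def)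
  have "polynomial_function (\<lambda>t. br a (c t) + t *\<^sub>R br b (c t))"
    by (intro polynomial_function_add polynomial_function_mult lin polynomial_function_id)
  then show ?thesis by (simp add: br_simps)
qed

lemma polynomial_curve_ad_pow:
  "polynomial_function (\<lambda>t::real. (br (a + t *\<^sub>R b) ^^ n) v)"
  by (induction n) (auto intro: polynomial_curve_br)

definition null0 :: "'g \<Rightarrow> 'g set" where
  "null0 h = nilspace (br h)"

lemma subspace_null0: "subspace (null0 h)"
  unfolding null0_def by (rule subspace_nilspace[OF linear_br])

lemma null0_eq: "null0 h = {v. (br h ^^ DIM('g)) v = 0}"
  unfolding null0_def by (rule nilspace_eq[OF linear_br])

lemma self_in_null0: "h \<in> null0 h"
  unfolding null0_def nilspace_def by (auto intro: exI[of _ 1])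

lemma null0_step: "br h v \<in> null0 h \<Longrightarrow> v \<in> null0 h"
  unfolding null0_def by (rule nilspace_step)

lemma null0_subalgebra: "lie_subalgebra br (null0 h)"
  unfolding lie_subalgebra_def
proof (intro conjI ballI subspace_null0)
  fix x y assume "x \<in> null0 h" "y \<in> null0 h"
  then show "br x y \<in> null0 h" unfolding null0_def
    by (rule weighted_leibniz[OF linear_br linear_br linear_br br_jacobi])
qed

lemma br_in_null0: "x \<in> null0 h \<Longrightarrow> y \<in> null0 h \<Longrightarrow> br x y \<in> null0 h"
  using null0_subalgebra by (simp add: lie_subalgebra_def)

text \<open>
Move from \<open>h\<close> to \<open>x\<close> along \<open>ht t = h + t (x - h)\<close>. Modulo \<open>null0 h\<close> the operator \<open>ad h\<close> is
invertible, and so is \<open>ad (ht t)\<close> for small \<open>t\<close>; hence \<open>null0 (ht t) \<subseteq> null0 h\<close>, with equality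
by minimality. So \<open>ad (ht t)\<close> is nilpotent on \<open>null0 h\<close> for small \<open>t\<close>, and then for all \<open>t\<close>, since
this is a polynomial identity in \<open>t\<close>; take \<open>t = 1\<close>.
\<close>
lemma minimal_nullity_nilpotent:
  assumes U: "subspace U" "h \<in> U" and min: "\<And>x. x \<in> U \<Longrightarrow> dim (null0 h) \<le> dim (null0 x)"
    and x: "x \<in> U" "x \<in> null0 h" and v: "v \<in> null0 h"
  shows "(br x ^^ DIM('g)) v = 0"
proof -
  let ?V = "null0 h"
  obtain p where p: "linear p" "\<And>x. p x \<in> ?V" "\<And>x. x \<in> ?V \<Longrightarrow> p x = x"
    using orthogonal_projection[OF subspace_null0] by metis
  define q where "q v = v - p v" for v
  have linq: "linear q" unfolding q_def by (intro linear_compose_sub linear_id[unfolded id_def] p)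
  have pp: "p (p v) = p v" and pq: "p (q v) = 0" and qq: "q (q v) = q v" for v
    using p(2,3) by (auto simp: q_def linear_diff[OF p(1)])
  have q0: "q v = 0 \<longleftrightarrow> v \<in> ?V" for v using p(2)[of v] p(3)[of v] by (auto simp: q_def)
  \<comment> \<open>\<open>f y\<close> is \<open>ad y\<close> compressed to the orthogonal complement of \<open>null0 h\<close>, completed by the identity
    on \<open>null0 h\<close> so that invertibility becomes injectivity on the whole space.\<close>
  define f where "f y v = q (br y (q v)) + p v" for y v
  have linf: "linear (f y)" for y unfolding f_def
    by (intro linear_compose_add p(1) linear_compose[OF linear_compose[OF linq linear_br] linq, unfolded o_def])
  have f0: "br y (q v) \<in> ?V \<and> p v = 0" if "f y v = 0" for y v
  proof -
    have "p (f y v) = p v" by (simp add: f_def linear_add[OF p(1)] pq pp)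
    then have "p v = 0" using that linear_0[OF p(1)] by simp
    then show ?thesis using that q0 by (simp add: f_def)
  qed
  have "inj (f h)"
  proof (rule linear_injective_0[OF linf, THEN iffD2], intro allI impI)
    fix v assume "f h v = 0"
    then have "br h (q v) \<in> ?V" "p v = 0" using f0 by auto
    then show "v = 0" using null0_step q0[of "q v"] qq by (simp add: q_def)
  qed
  then obtain B where B: "B > 0" "\<And>v. B * norm v \<le> norm (f h v)"
    using linear_inj_bounded_below_pos[OF linf] by blast
  define ht where "ht t = h + t *\<^sub>R (x - h)" for t :: real
  have ht: "ht t \<in> U" "ht t \<in> ?V" for t unfolding ht_def using U x self_in_null0
    by (auto intro!: subspace_add subspace_scale subspace_diff subspace_null0)
  define g where "g v = q (br (x - h) (q v))" for v
  have ling: "linear g" unfolding g_def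
    by (rule linear_compose[OF linear_compose[OF linq linear_br] linq, unfolded o_def])
  obtain C where C: "C > 0" "\<And>v. norm (g v) \<le> C * norm v"
    using linear_bounded_pos[OF ling] by blast
  have eq: "null0 (ht t) = ?V" if t: "\<bar>t\<bar> < B / C" for t
  proof -
    have step: "v \<in> ?V" if v: "br (ht t) v \<in> ?V" for v
    proof -
      have "br (ht t) (q v) = br (ht t) v - br (ht t) (p v)" by (simp add: q_def br_simps)
      also have "\<dots> \<in> ?V" by (intro subspace_diff subspace_null0 v br_in_null0 ht p)
      finally have "q (br (ht t) (q (q v))) = 0" by (simp add: q0 qq)
      moreover have "f (ht t) (q v) = f h (q v) + t *\<^sub>R g (q v)"
        by (simp add: f_def g_def ht_def br_simps linear_add[OF linq] linear_cmul[OF linq])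
      ultimately have "f h (q v) = - (t *\<^sub>R g (q v))"
        by (simp add: f_def pq eq_neg_iff_add_eq_0)
      then have "B * norm (q v) \<le> \<bar>t\<bar> * norm (g (q v))" using B(2)[of "q v"] by simp
      also have "\<dots> \<le> \<bar>t\<bar> * (C * norm (q v))" by (intro mult_left_mono C) auto
      finally have "(B - \<bar>t\<bar> * C) * norm (q v) \<le> 0" by (simp add: algebra_simps)
      moreover have "B - \<bar>t\<bar> * C > 0" using t C(1) by (simp add: field_simps)
      ultimately have "q v = 0" by (simp add: mult_le_0_iff)
      then show ?thesis by (simp add: q0)
    qed
    have "v \<in> ?V" if "(br (ht t) ^^ n) v = 0" for n v
      using that
    proof (induction n arbitrary: v)
      case 0
      then show ?case by (simp add: subspace_0[OF subspace_null0])
    next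
      case (Suc n)
      then show ?case using step by (simp add: funpow_swap1)
    qed
    then have "null0 (ht t) \<subseteq> ?V" by (auto simp: null0_def nilspace_def)
    then show ?thesis using min[OF ht(1)] by (intro subspace_dim_equal subspace_null0)
  qed
  let ?c = "\<lambda>t. (br (h + t *\<^sub>R (x - h)) ^^ DIM('g)) v"
  have "{0<..<B / C} \<subseteq> {t. ?c t = 0}"
  proof
    fix t assume "t \<in> {0<..<B / C}"
    then have "null0 (ht t) = ?V" using eq by simp
    then show "t \<in> {t. ?c t = 0}" using v null0_eq[of "ht t"] by (auto simp: ht_def)
  qed
  moreover have "infinite {0<..<B / C}" using B(1) C(1) by (simp add: infinite_Ioo)
  ultimately have "infinite {t. ?c t = 0}" using finite_subset by blast
  from polynomial_curve_zero[OF polynomial_curve_ad_pow this, of 1] show ?thesis by simp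
qed

lemma exists_minimal_nullity:
  assumes "subspace U"
  obtains h where "h \<in> U" "\<And>x. x \<in> U \<Longrightarrow> dim (null0 h) \<le> dim (null0 x)"
  using ex_has_least_nat[of "\<lambda>x. x \<in> U" 0 "\<lambda>x. dim (null0 x)"] subspace_0[OF assms] by blast

text \<open>
For \<open>h\<close> of minimal nullity in \<open>A\<close>, the subalgebra \<open>A \<inter> null0 h\<close> is nilpotent by Engel's theorem.
It is its own normaliser because \<open>br h x \<in> null0 h\<close> already puts \<open>x\<close> into \<open>null0 h\<close>.
\<close>
lemma cartan_subalgebra_exists:
  assumes A: "lie_subalgebra br A"
  shows "\<exists>H. cartan_subalgebra br A H"
proof -
  have sA: "subspace A" and cA: "\<And>x y. x \<in> A \<Longrightarrow> y \<in> A \<Longrightarrow> br x y \<in> A"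
    using A by (auto simp: lie_subalgebra_def)
  obtain h where h: "h \<in> A" "\<And>x. x \<in> A \<Longrightarrow> dim (null0 h) \<le> dim (null0 x)"
    using exists_minimal_nullity[OF sA] by blast
  let ?H = "A \<inter> null0 h"
  have "lie_subalgebra br ?H"
    using subspace_inter[OF sA subspace_null0] cA br_in_null0 by (auto simp: lie_subalgebra_def)
  then have "nilpotent_subalgebra br ?H"
  proof (rule ad_nilpotent_imp_nilpotent)
    fix x y assume "x \<in> ?H" "y \<in> ?H"
    then show "\<exists>n. (br x ^^ n) y = 0" using minimal_nullity_nilpotent[OF sA h] by blast
  qed
  moreover have "lie_normalizer br A ?H = ?H"
  proof
    show "?H \<subseteq> lie_normalizer br A ?H" by (auto simp: lie_normalizer_def cA br_in_null0)
    show "lie_normalizer br A ?H \<subseteq> ?H"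
    proof
      fix x assume "x \<in> lie_normalizer br A ?H"
      then have x: "x \<in> A" "br x h \<in> null0 h" using h(1) self_in_null0 by (auto simp: lie_normalizer_def)
      then have "br h x \<in> null0 h" using br_anti[of h x] subspace_neg[OF subspace_null0] by metis
      then show "x \<in> ?H" using x null0_step by blast
    qed
  qed
  ultimately show ?thesis unfolding cartan_subalgebra_def by blast
qed

lemma cartan_subset_null0:
  assumes "nilpotent_subalgebra br H" "y \<in> H" shows "H \<subseteq> null0 y"
  using nilpotent_imp_ad_nilpotent[OF assms] by (auto simp: null0_def nilspace_def)

text \<open>
By nilpotency \<open>H \<subseteq> null0 h\<close> for each \<open>h \<in> H\<close>. If the inclusion were proper for an \<open>h\<close> of
minimal nullity in \<open>H\<close>, then \<open>H\<close> would act nilpotently on \<open>null0 h\<close> and Engel's theorem would give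
an element outside \<open>H\<close> that normalises \<open>H\<close>.
\<close>
lemma cartan_regular_element:
  assumes H: "cartan_subalgebra br UNIV H"
  obtains h where "h \<in> H" "null0 h = H"
proof -
  have nil: "nilpotent_subalgebra br H" and norm: "lie_normalizer br UNIV H = H"
    using H by (auto simp: cartan_subalgebra_def)
  have sub: "lie_subalgebra br H" using nil by (simp add: nilpotent_subalgebra_def)
  then have sH: "subspace H" and cH: "\<And>x y. x \<in> H \<Longrightarrow> y \<in> H \<Longrightarrow> br x y \<in> H"
    by (auto simp: lie_subalgebra_def)
  obtain h where h: "h \<in> H" "\<And>x. x \<in> H \<Longrightarrow> dim (null0 h) \<le> dim (null0 x)"
    using exists_minimal_nullity[OF sH] by blast
  have H0: "H \<subseteq> null0 h" by (rule cartan_subset_null0[OF nil h(1)])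
  have "null0 h = H"
  proof (rule ccontr)
    assume "null0 h \<noteq> H"
    then have psub: "H \<subset> null0 h" using H0 by blast
    have "\<exists>w\<in>null0 h - H. \<forall>x\<in>H. br x w \<in> H"
    proof (rule engel[OF sub sH subspace_null0 psub])
      show "br x w \<in> null0 h" if "x \<in> H" "w \<in> null0 h" for x w using that H0 br_in_null0 by blast
      show "br x u \<in> H" if "x \<in> H" "u \<in> H" for x u using that by (rule cH)
      show "\<exists>n. (br x ^^ n) w \<in> H" if "x \<in> H" "w \<in> null0 h" for x w
        using minimal_nullity_nilpotent[OF sH h that(1) _ that(2)] H0 that subspace_0[OF sH] by (metis subsetD)
      show "\<exists>n. (br x ^^ n) y = 0" if "x \<in> H" "y \<in> H" for x y
        using nilpotent_imp_ad_nilpotent[OF nil that] .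
    qed
    then obtain w where w: "w \<notin> H" "\<And>x. x \<in> H \<Longrightarrow> br x w \<in> H" by blast
    then have "br w x \<in> H" if "x \<in> H" for x using that br_anti[of w x] subspace_neg[OF sH] by metis
    then have "w \<in> lie_normalizer br UNIV H" by (simp add: lie_normalizer_def)
    then show False using norm w by blast
  qed
  then show ?thesis using that h(1) by blast
qed

lemma dim_null0_plus_rank: "dim (null0 h) + dim (range (br h ^^ DIM('g))) = DIM('g)"
proof -
  let ?R = "range (br h ^^ DIM('g))"
  have sR: "subspace ?R" by (rule linear_subspace_image[OF linear_funpow[OF linear_br] subspace_UNIV])
  have "{x + y |x y. x \<in> null0 h \<and> y \<in> ?R} = UNIV"
    using nilspace_range_decomp(2)[OF linear_br[of h]] unfolding null0_def by blast
  then show ?thesis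
    using dim_sums_Int[OF subspace_null0[of h] sR] nilspace_range_decomp(1)[OF linear_br[of h]]
    unfolding null0_def by simp
qed

text \<open>
The nullity of \<open>ad\<close> is the corank of its \<open>DIM('g)\<close>-th power. Vectors whose images form a basis
of the range at \<open>t = 1\<close> have independent images for all but finitely many \<open>t\<close>.
\<close>
lemma nullity_on_line:
  "finite {t::real. dim (null0 (a + t *\<^sub>R (b - a))) > dim (null0 b)}"
proof -
  let ?T = "\<lambda>t::real. br (a + t *\<^sub>R (b - a)) ^^ DIM('g)"
  obtain B where B: "B \<subseteq> range (?T 1)" "independent B" "card B = dim (range (?T 1))"
    using basis_exists[of "range (?T 1)"] by metis
  have finB: "finite B" using B(2) independent_imp_finite by blast
  define w where "w = inv_into UNIV (?T 1)"
  have w: "?T 1 (w x) = x" if "x \<in> B" for x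
    unfolding w_def by (rule f_inv_into_f) (use B(1) that in blast)
  let ?v = "\<lambda>x t. ?T t (w x)"
  have fin: "finite {t. \<exists>c. (\<Sum>x\<in>B. c x *\<^sub>R ?v x t) = 0 \<and> (\<exists>x\<in>B. c x \<noteq> 0)}"
  proof (rule independent_polynomial_curves[OF finB polynomial_curve_ad_pow, where s = 1])
    fix c assume "(\<Sum>x\<in>B. c x *\<^sub>R ?v x 1) = 0"
    then have "(\<Sum>x\<in>B. c x *\<^sub>R x) = 0" using w by simp
    then show "\<forall>x\<in>B. c x = 0" using B(2) finB by (simp add: independent_explicit)
  qed
  have le: "dim (null0 (a + t *\<^sub>R (b - a))) \<le> dim (null0 b)"
    if t: "\<And>c. (\<Sum>x\<in>B. c x *\<^sub>R ?v x t) = 0 \<Longrightarrow> (\<forall>x\<in>B. c x = 0)" for t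
  proof -
    have inj: "inj_on (\<lambda>x. ?v x t) B"
    proof (rule inj_onI, rule ccontr)
      fix x y assume xy: "x \<in> B" "y \<in> B" "?v x t = ?v y t" "x \<noteq> y"
      let ?c = "\<lambda>z. if z = x then 1 else if z = y then -1 else (0::real)"
      have "(\<Sum>z\<in>B. ?c z *\<^sub>R ?v z t) = (\<Sum>z\<in>{x, y}. ?c z *\<^sub>R ?v z t)"
        using xy(1,2) by (intro sum.mono_neutral_right[OF finB]) auto
      also have "\<dots> = 0" using xy(4) by (simp add: xy(3))
      finally have "(\<Sum>z\<in>B. ?c z *\<^sub>R ?v z t) = 0" .
      from t[OF this] have "?c x = 0" using xy(1) by (rule bspec)
      then show False by simp
    qed
    have "independent ((\<lambda>x. ?v x t) ` B)"
      unfolding independent_explicit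
    proof (intro conjI allI impI)
      show "finite ((\<lambda>x. ?v x t) ` B)" using finB by simp
      fix c assume "(\<Sum>z\<in>(\<lambda>x. ?v x t) ` B. c z *\<^sub>R z) = 0"
      then have "(\<Sum>x\<in>B. c (?v x t) *\<^sub>R ?v x t) = 0" by (simp add: sum.reindex[OF inj])
      from t[OF this] show "\<forall>z\<in>(\<lambda>x. ?v x t) ` B. c z = 0" by blast
    qed
    moreover have "(\<lambda>x. ?v x t) ` B \<subseteq> range (?T t)" by blast
    ultimately have "card ((\<lambda>x. ?v x t) ` B) \<le> dim (range (?T t))"
      using independent_card_le_dim by blast
    then have "dim (range (?T 1)) \<le> dim (range (?T t))" using B(3) card_image[OF inj] by simp
    then show ?thesis using dim_null0_plus_rank[of b] dim_null0_plus_rank[of "a + t *\<^sub>R (b - a)"] by simp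
  qed
  have "{t. dim (null0 (a + t *\<^sub>R (b - a))) > dim (null0 b)}
      \<subseteq> {t. \<exists>c. (\<Sum>x\<in>B. c x *\<^sub>R ?v x t) = 0 \<and> (\<exists>x\<in>B. c x \<noteq> 0)}"
    using le by (intro subsetI CollectI, elim CollectE) (meson leD)
  then show ?thesis using fin by (rule finite_subset)
qed

end

context lie_alg
begin

section \<open>Inner automorphisms\<close>

lemma bounded_bilinear_br: "bounded_bilinear br"
  using bilinear_br bilinear_conv_bounded_bilinear by blast

text \<open>
In coordinates this is the Cauchy product of absolutely convergent real series.
\<close>
lemma cauchy_product_br:
  assumes u: "summable (\<lambda>k. norm (u k))" and v: "summable (\<lambda>k. norm (v k))"
  shows "(\<lambda>n. \<Sum>k\<le>n. br (u k) (v (n - k))) sums br (\<Sum>k. u k) (\<Sum>k. v k)"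
proof -
  have expand: "br p q = (\<Sum>b\<in>Basis. \<Sum>c\<in>Basis. ((p \<bullet> b) * (q \<bullet> c)) *\<^sub>R br b c)" for p q
  proof -
    have "br p q = br (\<Sum>b\<in>Basis. (p \<bullet> b) *\<^sub>R b) (\<Sum>c\<in>Basis. (q \<bullet> c) *\<^sub>R c)"
      by (simp only: euclidean_representation)
    also have "\<dots> = (\<Sum>b\<in>Basis. br ((p \<bullet> b) *\<^sub>R b) (\<Sum>c\<in>Basis. (q \<bullet> c) *\<^sub>R c))"
      by (rule linear_sum[OF linear_br_left])
    also have "\<dots> = (\<Sum>b\<in>Basis. \<Sum>c\<in>Basis. ((p \<bullet> b) * (q \<bullet> c)) *\<^sub>R br b c)"
      by (simp only: linear_sum[OF linear_br] br_simps scaleR_scaleR scaleR_sum_right mult.commute)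
    finally show ?thesis .
  qed
  have "(\<lambda>n. \<Sum>b\<in>Basis. \<Sum>c\<in>Basis. (\<Sum>k\<le>n. (u k \<bullet> b) * (v (n - k) \<bullet> c)) *\<^sub>R br b c) sums
      (\<Sum>b\<in>Basis. \<Sum>c\<in>Basis. (((\<Sum>k. u k) \<bullet> b) * ((\<Sum>k. v k) \<bullet> c)) *\<^sub>R br b c)"
  proof (intro sums_sum)
    fix b c :: 'g assume b: "b \<in> Basis" and c: "c \<in> Basis"
    have "summable (\<lambda>k. norm (u k \<bullet> b))"
      by (rule summable_comparison_test'[OF u, of 0]) (use Basis_le_norm[OF b] in auto)
    moreover have "summable (\<lambda>k. norm (v k \<bullet> c))"
      by (rule summable_comparison_test'[OF v, of 0]) (use Basis_le_norm[OF c] in auto)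
    ultimately have "(\<lambda>n. \<Sum>k\<le>n. (u k \<bullet> b) * (v (n - k) \<bullet> c)) sums ((\<Sum>k. u k \<bullet> b) * (\<Sum>k. v k \<bullet> c))"
      by (rule Cauchy_product_sums)
    also have "(\<Sum>k. u k \<bullet> b) = (\<Sum>k. u k) \<bullet> b"
      by (rule bounded_linear.suminf[OF bounded_linear_inner_left summable_norm_cancel[OF u], symmetric])
    also have "(\<Sum>k. v k \<bullet> c) = (\<Sum>k. v k) \<bullet> c"
      by (rule bounded_linear.suminf[OF bounded_linear_inner_left summable_norm_cancel[OF v], symmetric])
    finally show "(\<lambda>n. (\<Sum>k\<le>n. (u k \<bullet> b) * (v (n - k) \<bullet> c)) *\<^sub>R br b c) sums
        ((((\<Sum>k. u k) \<bullet> b) * ((\<Sum>k. v k) \<bullet> c)) *\<^sub>R br b c)"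
      by (rule bounded_linear.sums[OF bounded_linear_scaleR_left])
  qed
  moreover have "(\<Sum>b\<in>Basis. \<Sum>c\<in>Basis. (\<Sum>k\<le>n. (u k \<bullet> b) * (v (n - k) \<bullet> c)) *\<^sub>R br b c)
      = (\<Sum>k\<le>n. br (u k) (v (n - k)))" for n
  proof -
    have "(\<Sum>k\<le>n. br (u k) (v (n - k))) =
        (\<Sum>k\<le>n. \<Sum>b\<in>Basis. \<Sum>c\<in>Basis. ((u k \<bullet> b) * (v (n - k) \<bullet> c)) *\<^sub>R br b c)"
      by (simp only: expand[of "u _"])
    also have "\<dots> = (\<Sum>b\<in>Basis. \<Sum>k\<le>n. \<Sum>c\<in>Basis. ((u k \<bullet> b) * (v (n - k) \<bullet> c)) *\<^sub>R br b c)"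
      by (rule sum.swap)
    also have "\<dots> = (\<Sum>b\<in>Basis. \<Sum>c\<in>Basis. \<Sum>k\<le>n. ((u k \<bullet> b) * (v (n - k) \<bullet> c)) *\<^sub>R br b c)"
      by (intro sum.cong refl sum.swap)
    finally show ?thesis by (simp only: scaleR_sum_left)
  qed
  ultimately show ?thesis by (simp only: expand[of "suminf u"])
qed

definition exp_term :: "'g \<Rightarrow> nat \<Rightarrow> 'g \<Rightarrow> 'g" where
  "exp_term x n v = (br x ^^ n) v /\<^sub>R fact n"

definition exp_ad :: "'g \<Rightarrow> 'g \<Rightarrow> 'g" where
  "exp_ad x v = (\<Sum>n. exp_term x n v)"

definition br_bound :: real where
  "br_bound = (SOME B. B > 0 \<and> (\<forall>x y. norm (br x y) \<le> B * norm x * norm y))"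

lemma br_bound: "br_bound > 0" "norm (br x y) \<le> br_bound * norm x * norm y"
proof -
  have "\<exists>B>0. \<forall>x y. norm (br x y) \<le> B * norm x * norm y" by (rule bilinear_bounded_pos[OF bilinear_br])
  from someI_ex[OF this] show "br_bound > 0" "norm (br x y) \<le> br_bound * norm x * norm y"
    unfolding br_bound_def by auto
qed

lemma norm_exp_term: "norm (exp_term x n v) \<le> (br_bound * norm x) ^ n / fact n * norm v"
proof -
  have "norm ((br x ^^ n) v) \<le> (br_bound * norm x) ^ n * norm v"
  proof (induction n)
    case (Suc n)
    have "norm ((br x ^^ Suc n) v) \<le> br_bound * norm x * norm ((br x ^^ n) v)" using br_bound(2) by simp
    also have "\<dots> \<le> br_bound * norm x * ((br_bound * norm x) ^ n * norm v)"
      using Suc br_bound(1) by (intro mult_left_mono) auto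
    finally show ?case by (simp add: mult_ac)
  qed simp
  then show ?thesis by (simp add: exp_term_def divide_simps)
qed

lemma summable_exp_bound: "summable (\<lambda>n. c ^ n / fact n * d :: real)"
  using summable_mult2[OF summable_exp[of c], of d] by (simp add: field_simps)

lemma summable_exp_term_norm: "summable (\<lambda>n. norm (exp_term x n v))"
  by (rule summable_comparison_test'[OF summable_exp_bound, of 0]) (use norm_exp_term in auto)

lemma summable_exp_term: "summable (\<lambda>n. exp_term x n v)"
  by (rule summable_norm_cancel[OF summable_exp_term_norm])

lemma linear_exp_term: "linear (exp_term x n)"
  unfolding exp_term_def by (rule linear_compose_scale_right[OF linear_funpow[OF linear_br]])

lemma linear_exp_ad: "linear (exp_ad x)"
  unfolding exp_ad_def
  by (rule linearI) (simp_all add: linear_add[OF linear_exp_term] linear_cmul[OF linear_exp_term]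
      suminf_add[OF summable_exp_term summable_exp_term] suminf_scaleR_right[OF summable_exp_term])

lemma exp_term_Suc: "real (Suc n) *\<^sub>R exp_term x (Suc n) v = br x (exp_term x n v)"
  by (simp add: exp_term_def br_simps divide_simps)

text \<open>
The divided powers \<open>(ad x)^n / n!\<close> of a derivation satisfy the Leibniz rule with all binomial
coefficients absorbed.
\<close>
lemma exp_term_leibniz:
  "exp_term x n (br u v) = (\<Sum>k\<le>n. br (exp_term x k u) (exp_term x (n - k) v))"
proof (induction n)
  case 0
  then show ?case by (simp add: exp_term_def)
next
  case (Suc n)
  let ?u = "\<lambda>k. exp_term x k u" and ?v = "\<lambda>k. exp_term x k v"
  have a: "(\<Sum>k\<le>n. br (br x (?u k)) (?v (n - k))) = (\<Sum>k\<le>Suc n. real k *\<^sub>R br (?u k) (?v (Suc n - k)))"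
    by (simp add: sum.atMost_Suc_shift exp_term_Suc[symmetric] br_simps del: sum.atMost_Suc of_nat_Suc)
  have "(\<Sum>k\<le>n. br (?u k) (br x (?v (n - k)))) = (\<Sum>k\<le>n. real (Suc n - k) *\<^sub>R br (?u k) (?v (Suc n - k)))"
    by (rule sum.cong) (auto simp: exp_term_Suc[symmetric] br_simps Suc_diff_le simp del: of_nat_Suc)
  then have b: "(\<Sum>k\<le>n. br (?u k) (br x (?v (n - k)))) = (\<Sum>k\<le>Suc n. real (Suc n - k) *\<^sub>R br (?u k) (?v (Suc n - k)))"
    by simp
  have "real (Suc n) *\<^sub>R exp_term x (Suc n) (br u v) = br x (exp_term x n (br u v))" by (rule exp_term_Suc)
  also have "\<dots> = (\<Sum>k\<le>n. br (br x (?u k)) (?v (n - k))) + (\<Sum>k\<le>n. br (?u k) (br x (?v (n - k))))"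
    unfolding Suc linear_sum[OF linear_br] sum.distrib[symmetric] by (rule sum.cong[OF refl br_jacobi])
  also have "\<dots> = (\<Sum>k\<le>Suc n. real (Suc n) *\<^sub>R br (?u k) (?v (Suc n - k)))"
    unfolding a b sum.distrib[symmetric]
    by (rule sum.cong) (auto simp flip: scaleR_add_left simp del: of_nat_Suc simp: of_nat_diff)
  also have "\<dots> = real (Suc n) *\<^sub>R (\<Sum>k\<le>Suc n. br (?u k) (?v (Suc n - k)))"
    by (simp only: scaleR_sum_right)
  finally show ?case by (simp del: of_nat_Suc sum.atMost_Suc)
qed

lemma exp_ad_br: "exp_ad x (br u v) = br (exp_ad x u) (exp_ad x v)"
  unfolding exp_ad_def exp_term_leibniz
  by (rule sums_unique[symmetric]) (rule cauchy_product_br[OF summable_exp_term_norm summable_exp_term_norm])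

text \<open>
The first-order case \<open>m = 1\<close> gives injectivity for small \<open>x\<close>, the case \<open>m = 2\<close> gives the
derivative at zero.
\<close>
lemma exp_ad_remainder:
  "norm (exp_ad x v - (\<Sum>k<m. exp_term x k v)) \<le> (br_bound * norm x) ^ m * exp (br_bound * norm x) * norm v"
proof -
  let ?c = "br_bound * norm x"
  have c: "?c \<ge> 0" using br_bound(1) by simp
  have "exp_ad x v - (\<Sum>k<m. exp_term x k v) = (\<Sum>n. exp_term x (n + m) v)"
    unfolding exp_ad_def using suminf_split_initial_segment[OF summable_exp_term, of x v m] by simp
  also have "norm \<dots> \<le> (\<Sum>n. norm (exp_term x (n + m) v))"
    by (rule summable_norm[OF summable_ignore_initial_segment[OF summable_exp_term_norm]])
  also have "\<dots> \<le> (\<Sum>n. ?c ^ n / fact n * (?c ^ m * norm v))"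
  proof (rule suminf_le)
    fix n
    have "norm (exp_term x (n + m) v) \<le> ?c ^ (n + m) / fact (n + m) * norm v" by (rule norm_exp_term)
    also have "\<dots> \<le> ?c ^ (n + m) / fact n * norm v"
      using c by (intro mult_right_mono divide_left_mono fact_mono) auto
    finally show "norm (exp_term x (n + m) v) \<le> ?c ^ n / fact n * (?c ^ m * norm v)"
      by (simp add: power_add mult_ac)
  qed (rule summable_ignore_initial_segment[OF summable_exp_term_norm] summable_exp_bound)+
  also have "\<dots> = exp ?c * (?c ^ m * norm v)"
    using sums_mult2[OF exp_converges[of ?c], of "?c ^ m * norm v"]
    by (intro sums_unique[symmetric]) (simp add: field_simps)
  finally show ?thesis by (simp add: mult_ac)
qed

text \<open>
As an endomorphism of the Lie algebra, \<open>exp_ad x\<close> intertwines \<open>ad y\<close> with \<open>ad (exp_ad x y)\<close>, so it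
carries one null space into the other; injectivity preserves the dimension.
\<close>
lemma exp_ad_null0:
  assumes "inj (exp_ad x)"
  shows "dim (null0 y) \<le> dim (null0 (exp_ad x y))"
proof -
  have pow: "(br (exp_ad x y) ^^ n) (exp_ad x v) = exp_ad x ((br y ^^ n) v)" for n v
    by (induction n) (auto simp: exp_ad_br)
  have "exp_ad x ` null0 y \<subseteq> null0 (exp_ad x y)"
  proof
    fix w assume "w \<in> exp_ad x ` null0 y"
    then obtain v n where "w = exp_ad x v" "(br y ^^ n) v = 0" by (auto simp: null0_def nilspace_def)
    then have "(br (exp_ad x y) ^^ n) w = 0" by (simp add: pow linear_0[OF linear_exp_ad])
    then show "w \<in> null0 (exp_ad x y)" by (auto simp: null0_def nilspace_def)
  qed
  moreover have "dim (exp_ad x ` null0 y) = dim (null0 y)"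
    by (rule dim_image_eq[OF linear_exp_ad]) (rule inj_on_subset[OF assms subset_UNIV])
  ultimately show ?thesis by (metis dim_subset)
qed

text \<open>
Under the hypothesis \<open>exp_ad x\<close> differs from the identity by an operator of norm at most
\<open>1/4 * exp (1/4) < 1\<close>.
\<close>
lemma inj_exp_ad:
  assumes "br_bound * norm x \<le> 1/4"
  shows "inj (exp_ad x)"
proof (rule linear_injective_0[OF linear_exp_ad, THEN iffD2], intro allI impI)
  fix v assume v: "exp_ad x v = 0"
  let ?c = "br_bound * norm x"
  have c: "?c \<ge> 0" using br_bound(1) by simp
  have "norm v \<le> ?c * exp ?c * norm v"
    using exp_ad_remainder[of x v 1] v by (simp add: exp_term_def)
  also have "\<dots> \<le> (1/4) * 3 * norm v"
  proof (intro mult_right_mono mult_mono)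
    have "exp ?c \<le> exp 1" using assms by simp
    then show "exp ?c \<le> 3" using exp_le by linarith
  qed (use assms c in auto)
  finally show "v = 0" by simp
qed

lemma continuous_on_exp_ad:
  fixes f g :: "'b::topological_space \<Rightarrow> 'g"
  assumes cont: "continuous_on S f" "continuous_on S g"
    and bound: "\<And>z. z \<in> S \<Longrightarrow> norm (f z) \<le> R" "\<And>z. z \<in> S \<Longrightarrow> norm (g z) \<le> R"
  shows "continuous_on S (\<lambda>z. exp_ad (f z) (g z))"
proof -
  have "uniform_limit S (\<lambda>n z. \<Sum>i<n. exp_term (f z) i (g z)) (\<lambda>z. \<Sum>i. exp_term (f z) i (g z)) sequentially"
  proof (rule Weierstrass_m_test)
    show "norm (exp_term (f z) n (g z)) \<le> (br_bound * R) ^ n / fact n * R" if "z \<in> S" for n z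
    proof -
      have "norm (exp_term (f z) n (g z)) \<le> (br_bound * norm (f z)) ^ n / fact n * norm (g z)"
        by (rule norm_exp_term)
      also have "\<dots> \<le> (br_bound * R) ^ n / fact n * R"
      proof (rule mult_mono)
        have "br_bound * norm (f z) \<le> br_bound * R"
          using bound(1)[OF that] br_bound(1) by simp
        then have "(br_bound * norm (f z)) ^ n \<le> (br_bound * R) ^ n"
          using br_bound(1) by (intro power_mono) auto
        then show le: "(br_bound * norm (f z)) ^ n / fact n \<le> (br_bound * R) ^ n / fact n"
          by (simp add: divide_right_mono)
        have "0 \<le> (br_bound * norm (f z)) ^ n / fact n" using br_bound(1) by simp
        then show "0 \<le> (br_bound * R) ^ n / fact n" using le by linarith
      qed (use bound(2)[OF that] in auto)
      finally show ?thesis .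
    qed
    show "summable (\<lambda>n. (br_bound * R) ^ n / fact n * R)" by (rule summable_exp_bound)
  qed
  moreover have "continuous_on S (\<lambda>z. \<Sum>i<n. exp_term (f z) i (g z))" for n
  proof -
    have "continuous_on S (\<lambda>z. (br (f z) ^^ i) (g z))" for i
      by (induction i) (auto intro: cont bounded_bilinear.continuous_on[OF bounded_bilinear_br])
    then show ?thesis unfolding exp_term_def by (intro continuous_intros) auto
  qed
  ultimately show ?thesis unfolding exp_ad_def
    by (intro uniform_limit_theorem[where F = sequentially]) auto
qed

section \<open>Cartan subalgebras have equal dimension\<close>

text \<open>
The Fitting decomposition gives \<open>G = [h, G] + H\<close>, so there are linear maps \<open>a\<close> and \<open>b\<close> with
\<open>z = br (a z) h + b z\<close> and \<open>b z \<in> H\<close>. Then \<open>F z = exp_ad (a z) (h + b z)\<close> has the identity as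
derivative at zero, and its image is a neighbourhood of \<open>h\<close> by the open mapping theorem. Its values
are conjugate to elements of \<open>H\<close>, whose nullity is at least \<open>dim H\<close> by nilpotency.
\<close>
lemma nullity_near_regular:
  assumes nil: "nilpotent_subalgebra br H" and h: "h \<in> H" "null0 h = H"
  obtains e where "e > 0" "\<And>y. y \<in> ball h e \<Longrightarrow> dim H \<le> dim (null0 y)"
proof -
  have sH: "subspace H" using nil by (simp add: nilpotent_subalgebra_def lie_subalgebra_def)
  obtain p where p: "linear p" "\<And>x. p x \<in> H" "\<And>x. x \<in> H \<Longrightarrow> p x = x"
    using orthogonal_projection[OF sH] by metis
  define s where "s z = br (fst z) h + p (snd z)" for z
  have lins: "linear s" unfolding s_def
    by (rule linearI) (auto simp: br_simps linear_add[OF p(1)] linear_cmul[OF p(1)] algebra_simps)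
  have "surj s" unfolding surj_def
  proof
    fix v
    obtain u w where u: "u \<in> H" and v: "v = u + (br h ^^ DIM('g)) w"
      using nilspace_range_decomp(2)[OF linear_br[of h], of v] h(2) unfolding null0_def by blast
    obtain m where m: "DIM('g) = Suc m" using DIM_positive[where 'a = 'g] by (metis Suc_pred')
    have "v = s (- (br h ^^ m) w, u)"
      using br_anti[of "(br h ^^ m) w" h] by (simp add: s_def v m p(3)[OF u] br_simps)
    then show "\<exists>z. v = s z" by blast
  qed
  then obtain r where r: "linear r" "s \<circ> r = id" using linear_surjective_right_inverse[OF lins] by blast
  define a where "a z = fst (r z)" for z
  define b where "b z = p (snd (r z))" for z
  have lina: "linear a" unfolding a_def
    by (rule linearI) (auto simp: linear_add[OF r(1)] linear_cmul[OF r(1)])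
  have linb: "linear b" unfolding b_def
    by (rule linearI) (auto simp: linear_add[OF r(1)] linear_cmul[OF r(1)] linear_add[OF p(1)] linear_cmul[OF p(1)])
  have bH: "b z \<in> H" for z by (simp add: b_def p)
  have ab: "br (a z) h + b z = z" for z
    using fun_cong[OF r(2), of z] by (simp add: s_def a_def b_def)
  obtain A where A: "A > 0" "\<And>z. norm (a z) \<le> A * norm z" using linear_bounded_pos[OF lina] by blast
  obtain B where B: "B > 0" "\<And>z. norm (b z) \<le> B * norm z" using linear_bounded_pos[OF linb] by blast
  define F where "F z = exp_ad (a z) (h + b z)" for z
  have F0: "F 0 = h"
  proof -
    have "exp_ad 0 h = h" using exp_ad_remainder[of 0 h 1] by (simp add: exp_term_def)
    then show ?thesis by (simp add: F_def linear_0[OF lina] linear_0[OF linb])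
  qed
  define S where "S = ball (0::'g) 1"
  have in_S: "norm (a z) \<le> A + norm h + B" "norm (h + b z) \<le> A + norm h + B" if "z \<in> S" for z
  proof -
    have z: "norm z \<le> 1" using that by (simp add: S_def)
    have "A * norm z \<le> A" "B * norm z \<le> B" using z A(1) B(1) by auto
    then show "norm (a z) \<le> A + norm h + B" "norm (h + b z) \<le> A + norm h + B"
      using A(2)[of z] B(2)[of z] A(1) B(1) norm_ge_zero[of h] norm_triangle_ineq[of h "b z"] by linarith+
  qed
  have contF: "continuous_on S F" unfolding F_def
    by (rule continuous_on_exp_ad[OF _ _ in_S]; (intro continuous_on_add continuous_on_const)?)
      (use lina linb in \<open>auto intro: linear_continuous_on simp: linear_conv_bounded_linear\<close>)
  define M where "M = (br_bound * A)\<^sup>2 * exp (br_bound * A) * (norm h + B) + br_bound * A * B"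
  have est: "norm (F z - F 0 - z) \<le> M * (norm z)\<^sup>2" if "z \<in> S" for z
  proof -
    have z: "norm z \<le> 1" using that by (simp add: S_def)
    let ?y = "h + b z" and ?c = "br_bound * norm (a z)"
    have c: "0 \<le> ?c" "?c \<le> br_bound * A * norm z"
      using A(2)[of z] br_bound(1) by (simp_all add: mult.assoc)
    have c1: "?c \<le> br_bound * A" using c(2) z br_bound(1) A(1)
      by (meson mult_left_le mult_nonneg_nonneg less_imp_le order_trans)
    have y: "norm ?y \<le> norm h + B"
      using norm_triangle_ineq[of h "b z"] B(2)[of z] mult_left_le[of "norm z" B] z B(1) by linarith
    have "F z - F 0 - z = (exp_ad (a z) ?y - (\<Sum>k<2. exp_term (a z) k ?y)) + br (a z) (b z)"
      using ab[of z] by (simp add: F0 F_def[of z] exp_term_def numeral_2_eq_2 br_simps algebra_simps)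
    also have "norm \<dots> \<le> ?c ^ 2 * exp ?c * norm ?y + br_bound * norm (a z) * norm (b z)"
      by (rule order_trans[OF norm_triangle_ineq add_mono[OF exp_ad_remainder br_bound(2)]])
    also have "\<dots> \<le> (br_bound * A * norm z)^2 * exp (br_bound * A) * (norm h + B)
        + br_bound * (A * norm z) * (B * norm z)"
    proof (rule add_mono)
      show "?c ^ 2 * exp ?c * norm ?y \<le> (br_bound * A * norm z)^2 * exp (br_bound * A) * (norm h + B)"
        by (rule mult_mono[OF mult_mono[OF power_mono[OF c(2,1)] _] y]) (use c1 y B(1) in auto)
      have 1: "br_bound * norm (a z) \<le> br_bound * (A * norm z)" using A(2) br_bound(1) by simp
      have 2: "0 \<le> br_bound * (A * norm z)" using A(1) br_bound(1) by simp
      show "br_bound * norm (a z) * norm (b z) \<le> br_bound * (A * norm z) * (B * norm z)"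
        by (rule mult_mono[OF 1 B(2) 2 norm_ge_zero])
    qed
    also have "\<dots> = M * (norm z)\<^sup>2" by (simp add: M_def power2_eq_square algebra_simps)
    finally show ?thesis .
  qed
  have der: "(F has_derivative (\<lambda>z. z)) (at 0)"
  proof (rule has_derivativeI_sandwich[of 1])
    show "((\<lambda>z. M * norm z) \<longlongrightarrow> 0) (at 0)"
      by (rule tendsto_eq_intros refl | simp)+
    fix z :: 'g assume "z \<noteq> 0" "dist z 0 < 1"
    then have "norm (F z - F 0 - z) \<le> M * norm z * norm z" using est[of z] by (simp add: S_def power2_eq_square)
    then show "norm (F z - F 0 - (z - 0)) / norm (z - 0) \<le> M * norm z"
      using \<open>z \<noteq> 0\<close> by (simp add: divide_simps)
  qed auto
  \<comment> \<open>This radius makes \<open>inj_exp_ad\<close> applicable to every \<open>a z\<close> with \<open>norm z < d\<close>.\<close>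
  define d where "d = min 1 (1 / (4 * br_bound * A))"
  have d: "d > 0" using A(1) br_bound(1) by (simp add: d_def)
  have "F 0 \<in> interior (F ` ball 0 d)"
    by (rule sussmann_open_mapping[OF _ contF _ der, of "\<lambda>z. z"])
      (use d in \<open>auto simp: S_def d_def bounded_linear_ident\<close>)
  then obtain e where e: "e > 0" "ball h e \<subseteq> F ` ball 0 d"
    unfolding F0 mem_interior by blast
  have "dim H \<le> dim (null0 y)" if y: "y \<in> ball h e" for y
  proof -
    obtain z where z: "norm z < d" "y = F z" using e(2) y by auto
    have "br_bound * norm (a z) \<le> br_bound * (A * d)"
      using A z(1) br_bound(1) by (intro mult_left_mono order_trans[OF A(2)]) auto
    also have "\<dots> \<le> br_bound * (A * (1 / (4 * br_bound * A)))"
      using A(1) br_bound(1) by (intro mult_left_mono) (auto simp: d_def)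
    also have "\<dots> = 1/4" using A(1) br_bound(1) by simp
    finally have "inj (exp_ad (a z))" by (rule inj_exp_ad)
    then have "dim (null0 (h + b z)) \<le> dim (null0 y)" unfolding z(2) F_def by (rule exp_ad_null0)
    moreover have "H \<subseteq> null0 (h + b z)"
      using cartan_subset_null0[OF nil] subspace_add[OF sH h(1) bH] by blast
    then have "dim H \<le> dim (null0 (h + b z))" by (rule dim_subset)
    ultimately show ?thesis by simp
  qed
  then show ?thesis using that e(1) by blast
qed

text \<open>
On the line from \<open>h\<close> to \<open>y\<close> the nullity is at least \<open>dim H\<close> near \<open>h\<close>, and it exceeds that of
\<open>y\<close> only at finitely many points.
\<close>
lemma cartan_dim_le_nullity:
  assumes "cartan_subalgebra br UNIV H"
  shows "dim H \<le> dim (null0 y)"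
proof (rule ccontr)
  assume c: "\<not> dim H \<le> dim (null0 y)"
  obtain h where h: "h \<in> H" "null0 h = H" by (rule cartan_regular_element[OF assms])
  have nil: "nilpotent_subalgebra br H" using assms by (simp add: cartan_subalgebra_def)
  obtain e where e: "e > 0" "\<And>y. y \<in> ball h e \<Longrightarrow> dim H \<le> dim (null0 y)"
    by (rule nullity_near_regular[OF nil h]) blast
  define d where "d = e / (norm (y - h) + 1)"
  have d: "d > 0" using e(1) by (simp add: d_def add_nonneg_pos)
  have "{0<..<d} \<subseteq> {t. dim (null0 (h + t *\<^sub>R (y - h))) > dim (null0 y)}"
  proof
    fix t assume t: "t \<in> {0<..<d}"
    have "dist h (h + t *\<^sub>R (y - h)) = t * norm (y - h)" using t by (simp add: dist_norm)
    also have "\<dots> \<le> t * (norm (y - h) + 1)" using t by (intro mult_left_mono) auto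
    also have "\<dots> < e" using t by (simp add: d_def pos_less_divide_eq add_nonneg_pos)
    finally have "dim H \<le> dim (null0 (h + t *\<^sub>R (y - h)))" by (intro e(2)) simp
    then show "t \<in> {t. dim (null0 (h + t *\<^sub>R (y - h))) > dim (null0 y)}" using c by simp
  qed
  then have "finite {0<..<d}" using nullity_on_line finite_subset by blast
  then show False using infinite_Ioo[OF d] by blast
qed

lemma cartan_dim_unique:
  assumes "cartan_subalgebra br UNIV H1" "cartan_subalgebra br UNIV H2"
  shows "dim H1 = dim H2"
proof -
  have "dim H \<le> dim H'" if "cartan_subalgebra br UNIV H" "cartan_subalgebra br UNIV H'" for H H'
    using cartan_regular_element[OF that(2)] cartan_dim_le_nullity[OF that(1)] by metis
  then show ?thesis using assms by (meson le_antisym)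
qed

end

section \<open>The central element defined by the symplectic form\<close>

text \<open>
The element \<open>z\<close> represents \<open>\<Omega>\<close>: one has \<open>killing (br z x) y = \<Omega> (\<pi> x) (\<pi> y)\<close>, with \<open>\<pi>\<close> the
projection onto \<open>P\<close> along \<open>K\<close>.
\<close>
lemma symplectic_triple_central_element:
  fixes br :: "'g::euclidean_space \<Rightarrow> 'g \<Rightarrow> 'g"
  assumes triple: "symplectic_symmetric_triple br \<sigma> \<Omega>" and simple: "simple_lie_algebra br"
  obtains z where "z \<in> lie_centre br (canonical_K \<sigma>)"
    "\<And>x. br z x \<in> canonical_P \<sigma>" "\<And>x. br z x = 0 \<longleftrightarrow> x \<in> canonical_K \<sigma>"
proof -
  let ?K = "canonical_K \<sigma>" and ?P = "canonical_P \<sigma>"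
  have inv: "involutive_automorphism br \<sigma>" and sym: "symplectic_form_on ?P \<Omega>"
    and invar: "\<And>k x y. k \<in> ?K \<Longrightarrow> x \<in> ?P \<Longrightarrow> y \<in> ?P \<Longrightarrow> \<Omega> (br k x) y + \<Omega> x (br k y) = 0"
    using triple by (auto simp: symplectic_symmetric_triple_def)
  interpret lie_alg br using simple by (simp add: lie_alg_def simple_lie_algebra_def)
  have lin\<sigma>: "linear \<sigma>" and \<sigma>br: "\<And>x y. \<sigma> (br x y) = br (\<sigma> x) (\<sigma> y)" and \<sigma>\<sigma>: "\<And>x. \<sigma> (\<sigma> x) = x"
    using inv by (auto simp: involutive_automorphism_def)
  note \<sigma>_simps = linear_add[OF lin\<sigma>] linear_diff[OF lin\<sigma>] linear_cmul[OF lin\<sigma>] linear_neg[OF lin\<sigma>]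
  have K: "x \<in> ?K \<longleftrightarrow> \<sigma> x = x" and P: "x \<in> ?P \<longleftrightarrow> \<sigma> x = - x" for x
    by (auto simp: canonical_K_def canonical_P_def)
  define \<kappa> where "\<kappa> x = (1/2) *\<^sub>R (x + \<sigma> x)" for x
  define \<pi> where "\<pi> x = (1/2) *\<^sub>R (x - \<sigma> x)" for x
  have dec: "\<kappa> x + \<pi> x = x" for x by (simp add: \<kappa>_def \<pi>_def flip: scaleR_add_right)
  have \<kappa>K: "\<kappa> x \<in> ?K" and \<pi>P: "\<pi> x \<in> ?P" for x
    by (auto simp: K P \<kappa>_def \<pi>_def \<sigma>_simps \<sigma>\<sigma> add.commute simp flip: scaleR_minus_right)
  have \<pi>K: "\<pi> x = 0" if "x \<in> ?K" for x using that by (simp add: \<pi>_def K)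
  have \<pi>id: "\<pi> x = x" if "x \<in> ?P" for x using that by (simp add: \<pi>_def P flip: scaleR_2)
  have lin\<pi>: "linear \<pi>" by (rule linearI) (auto simp: \<pi>_def \<sigma>_simps algebra_simps)
  have brKK: "br x y \<in> ?K" if "x \<in> ?K" "y \<in> ?K" for x y using that by (simp add: K \<sigma>br)
  have brKP: "br x y \<in> ?P" if "x \<in> ?K" "y \<in> ?P" for x y using that by (simp add: K P \<sigma>br br_simps)
  have brPK: "br x y \<in> ?P" if "x \<in> ?P" "y \<in> ?K" for x y using that by (simp add: K P \<sigma>br br_simps)
  have brPP: "br x y \<in> ?K" if "x \<in> ?P" "y \<in> ?P" for x y using that by (simp add: K P \<sigma>br br_simps)
  have kill\<sigma>: "killing (\<sigma> x) (\<sigma> y) = killing x y" for x y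
  proof -
    let ?G = "\<lambda>v. br x (br y v)"
    have linG: "linear ?G" using linear_compose[OF linear_br linear_br] by (simp add: o_def)
    have "br (\<sigma> x) (br (\<sigma> y) v) = \<sigma> (?G (\<sigma> v))" for v by (simp add: \<sigma>br \<sigma>\<sigma>)
    then have "killing (\<sigma> x) (\<sigma> y) = tr (\<lambda>v. \<sigma> (?G (\<sigma> v)))" by (simp add: killing_def)
    also have "\<dots> = tr (\<lambda>v. ?G (\<sigma> (\<sigma> v)))"
      using tr_commute[OF lin\<sigma>, of "\<lambda>v. ?G (\<sigma> v)"] linear_compose[OF lin\<sigma> linG] by (simp add: o_def)
    finally show ?thesis by (simp add: \<sigma>\<sigma> killing_def)
  qed
  have killKP: "killing k p = 0" if "k \<in> ?K" "p \<in> ?P" for k p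
    using kill\<sigma>[of k p] that linear_neg[OF linear_killing, of k p] by (simp add: K P)
  note nd = killing_nondegenerate[OF simple]
  have Wadd: "\<Omega> (x + y) z = \<Omega> x z + \<Omega> y z" "\<Omega> z (x + y) = \<Omega> z x + \<Omega> z y"
    if "x \<in> ?P" "y \<in> ?P" "z \<in> ?P" for x y z
    using sym that unfolding symplectic_form_on_def by blast+
  have Wscale: "\<Omega> (c *\<^sub>R x) y = c * \<Omega> x y" "\<Omega> x (c *\<^sub>R y) = c * \<Omega> x y"
    if "x \<in> ?P" "y \<in> ?P" for c x y
    using sym that unfolding symplectic_form_on_def by blast+
  have Wself: "\<Omega> x x = 0" if "x \<in> ?P" for x using sym that by (simp add: symplectic_form_on_def)
  have Wnd: "x = 0" if "x \<in> ?P" "\<And>y. y \<in> ?P \<Longrightarrow> \<Omega> x y = 0" for x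
    using sym that by (simp add: symplectic_form_on_def)
  define W where "W x y = \<Omega> (\<pi> x) (\<pi> y)" for x y
  have linW: "linear (W x)" and linW': "linear (\<lambda>x. W x y)" for x y
    by (rule linearI; simp add: W_def linear_add[OF lin\<pi>] linear_cmul[OF lin\<pi>] Wadd Wscale \<pi>P)+
  have Wanti: "W y x = - W x y" for x y
  proof -
    have "W (x + y) (x + y) = W x x + W x y + (W y x + W y y)"
      by (simp add: linear_add[OF linW] linear_add[OF linW'])
    moreover have "W u u = 0" for u by (simp add: W_def Wself \<pi>P)
    ultimately show ?thesis by simp
  qed
  \<comment> \<open>\<open>K\<close>-invariance of \<open>\<Omega>\<close> is the cocycle identity on one element of \<open>K\<close> and two of \<open>P\<close>; the general
    case follows by decomposing the three arguments, since \<open>W\<close> vanishes on \<open>K\<close>.\<close>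
  have cocycle: "W (br x y) z = W x (br y z) + W y (br z x)" for x y z
  proof -
    have \<pi>br: "\<pi> (br x y) = br (\<kappa> x) (\<pi> y) + br (\<pi> x) (\<kappa> y)" for x y
    proof -
      have "br x y = br (\<kappa> x + \<pi> x) (\<kappa> y + \<pi> y)" by (simp only: dec)
      also have "\<dots> = (br (\<kappa> x) (\<kappa> y) + br (\<pi> x) (\<pi> y)) + (br (\<kappa> x) (\<pi> y) + br (\<pi> x) (\<kappa> y))"
        by (simp add: br_simps algebra_simps)
      finally show ?thesis
        by (simp add: linear_add[OF lin\<pi>] \<pi>K brKK brPP \<kappa>K \<pi>P \<pi>id brKP brPK)
    qed
    have flip: "br (\<pi> x) (\<kappa> y) = - br (\<kappa> y) (\<pi> x)" for x y by (rule br_anti)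
    have neg: "\<Omega> (- x) y = - \<Omega> x y" "\<Omega> x (- y) = - \<Omega> x y" if "x \<in> ?P" "y \<in> ?P" for x y
      using Wscale[OF that, of "-1"] by simp_all
    have negP: "- x \<in> ?P" if "x \<in> ?P" for x using that by (simp add: P \<sigma>_simps)
    have anti: "\<Omega> y x = - \<Omega> x y" if "x \<in> ?P" "y \<in> ?P" for x y
      using Wanti[of y x] that by (simp add: W_def \<pi>id)
    have e: "W (br x y) z = \<Omega> (br (\<kappa> x) (\<pi> y)) (\<pi> z) - \<Omega> (br (\<kappa> y) (\<pi> x)) (\<pi> z)" for x y z
    proof -
      have "\<Omega> (a + - b) c = \<Omega> a c - \<Omega> b c" if "a \<in> ?P" "b \<in> ?P" "c \<in> ?P" for a b c
        using Wadd(1)[OF that(1) negP[OF that(2)] that(3)] neg(1)[OF that(2,3)] by simp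
      then show ?thesis unfolding W_def \<pi>br flip by (simp only: brKP[OF \<kappa>K \<pi>P] \<pi>P)
    qed
    have i: "\<Omega> (br (\<kappa> x) (\<pi> y)) (\<pi> z) = \<Omega> (br (\<kappa> x) (\<pi> z)) (\<pi> y)" for x y z
      using invar[OF \<kappa>K \<pi>P \<pi>P, of x y z] anti[of "br (\<kappa> x) (\<pi> z)" "\<pi> y", OF brKP[OF \<kappa>K \<pi>P] \<pi>P] by simp
    have "W (br x y) z + W (br y z) x + W (br z x) y = 0"
      unfolding e using i[of x y z] i[of y x z] i[of z x y] by simp
    then show ?thesis using Wanti[of x "br y z"] Wanti[of y "br z x"] by simp
  qed
  have "\<exists>d. \<forall>y. killing d y = W x y" for x
    by (rule killing_riesz[OF nd linW[of x]]) blast+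
  then obtain D where D: "\<And>x y. killing (D x) y = W x y" by metis
  have eqI: "u = v" if "\<And>y. killing u y = killing v y" for u v
    using nd[of "u - v"] that linear_diff[OF linear_killing_left] by simp
  have "derivation D" unfolding derivation_def
  proof (intro conjI allI)
    show "linear D"
      by (intro linearI eqI) (simp_all add: D linear_add[OF linear_killing_left] linear_cmul[OF linear_killing_left]
          linear_add[OF linW'] linear_cmul[OF linW'])
    show "D (br x y) = br (D x) y + br x (D y)" for x y
    proof (rule eqI)
      fix z
      have "killing (br x (D y)) z = - killing (br (D y) x) z"
        using br_anti[of x "D y"] linear_neg[OF linear_killing_left] by metis
      also have "\<dots> = - W y (br x z)" by (simp add: killing_invariant D)
      also have "\<dots> = W y (br z x)" using br_anti[of z x] linear_neg[OF linW] by metis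
      finally have 1: "killing (br x (D y)) z = W y (br z x)" .
      have "killing (br (D x) y) z = W x (br y z)" by (simp add: killing_invariant D)
      then show "killing (D (br x y)) z = killing (br (D x) y + br x (D y)) z"
        by (simp add: D linear_add[OF linear_killing_left] 1 cocycle)
    qed
  qed
  from derivation_inner[OF nd this] obtain z where z: "\<And>x. D x = br z x" by blast
  have DK: "D x = 0 \<longleftrightarrow> x \<in> ?K" for x
  proof
    assume "x \<in> ?K"
    have "\<Omega> 0 y = 0" if "y \<in> ?P" for y using Wscale(1)[OF that that, of 0] by simp
    then have "W x y = 0" for y using \<open>x \<in> ?K\<close> by (simp add: W_def \<pi>K \<pi>P)
    then show "D x = 0" using nd[of "D x"] D by simp
  next
    assume "D x = 0"
    then have "W x y = 0" for y using D[of x y] linear_0[OF linear_killing_left] by simp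
    then have "\<Omega> (\<pi> x) y = 0" if "y \<in> ?P" for y using that by (metis W_def \<pi>id)
    then have "\<pi> x = 0" by (rule Wnd[OF \<pi>P])
    then show "x \<in> ?K" using dec[of x] \<kappa>K[of x] by simp
  qed
  have DP: "D x \<in> ?P" for x
  proof -
    have "\<kappa> (D x) = 0"
    proof (rule nd)
      fix y
      have "killing (\<kappa> (D x)) y = killing (\<kappa> (D x)) (\<kappa> y) + killing (\<kappa> (D x)) (\<pi> y)"
        by (simp add: dec flip: linear_add[OF linear_killing])
      also have "\<dots> = killing (\<kappa> (D x)) (\<kappa> y)" by (simp add: killKP \<kappa>K \<pi>P)
      also have "\<dots> = killing (\<kappa> (D x)) (\<kappa> y) + killing (\<pi> (D x)) (\<kappa> y)"
        using killing_commute killKP[OF \<kappa>K \<pi>P] by simp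
      also have "\<dots> = W x (\<kappa> y)" by (simp add: dec D flip: linear_add[OF linear_killing_left])
      also have "\<dots> = 0" using Wscale(2)[OF \<pi>P \<pi>P, of x 0] by (simp add: W_def \<pi>K[OF \<kappa>K])
      finally show "killing (\<kappa> (D x)) y = 0" .
    qed
    then show ?thesis using dec[of "D x"] \<pi>P[of "D x"] by simp
  qed
  have "z \<in> ?K" using DK[of z] z[of z] by simp
  then have "z \<in> lie_centre br ?K" using DK z by (simp add: lie_centre_def)
  then show ?thesis using that DP DK z by simp
qed

theorem theorem3p2p5:
  fixes br :: "'g::euclidean_space \<Rightarrow> 'g \<Rightarrow> 'g"
    and \<sigma> :: "'g \<Rightarrow> 'g"
    and \<Omega> :: "'g \<Rightarrow> 'g \<Rightarrow> real"
  assumes "symplectic_symmetric_triple br \<sigma> \<Omega>"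
    and "simple_lie_algebra br"
  shows "(\<forall>H. cartan_subalgebra br UNIV H \<and> lie_centre br (canonical_K \<sigma>) \<subseteq> H
              \<longrightarrow> H \<subseteq> canonical_K \<sigma>)
       \<and> (\<exists>r. has_lie_rank br (canonical_K \<sigma>) r \<and> has_lie_rank br UNIV r)"
proof -
  let ?K = "canonical_K \<sigma>"
  interpret lie_alg br using assms(2) by (simp add: lie_alg_def simple_lie_algebra_def)
  obtain z where zc: "z \<in> lie_centre br ?K" and zP: "\<And>x. br z x \<in> canonical_P \<sigma>"
    and zK: "\<And>x. br z x = 0 \<longleftrightarrow> x \<in> ?K"
    by (rule symplectic_triple_central_element[OF assms]) blast
  have KP: "x = 0" if "x \<in> ?K" "x \<in> canonical_P \<sigma>" for x
    using that by (simp add: canonical_K_def canonical_P_def eq_neg_iff_add_eq_0 flip: scaleR_2)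
  have lin\<sigma>: "linear \<sigma>" and \<sigma>br: "\<And>x y. \<sigma> (br x y) = br (\<sigma> x) (\<sigma> y)"
    using assms(1) by (auto simp: symplectic_symmetric_triple_def involutive_automorphism_def)
  have subK: "lie_subalgebra br ?K" unfolding lie_subalgebra_def canonical_K_def
    by (auto intro!: subspaceI simp: \<sigma>br linear_0[OF lin\<sigma>] linear_add[OF lin\<sigma>] linear_cmul[OF lin\<sigma>])
  \<comment> \<open>\<open>ad z\<close> maps into \<open>P\<close> and has kernel \<open>K\<close>, so its square has the same kernel.\<close>
  have nilK: "x \<in> ?K" if "(br z ^^ n) x = 0" for n x
    using that
  proof (induction n arbitrary: x)
    case 0
    then show ?case using zK[of 0] by (simp add: br_simps)
  next
    case (Suc n)
    then have "br z x \<in> ?K" by (simp add: funpow_swap1)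
    then have "br z x = 0" using KP zP by blast
    then show ?case using zK by blast
  qed
  have part1: "H \<subseteq> ?K" if H: "cartan_subalgebra br UNIV H" "lie_centre br ?K \<subseteq> H" for H
  proof
    fix x assume "x \<in> H"
    moreover have "z \<in> H" using zc H(2) by blast
    moreover have "nilpotent_subalgebra br H" using H(1) by (simp add: cartan_subalgebra_def)
    ultimately show "x \<in> ?K" using nilpotent_imp_ad_nilpotent nilK by blast
  qed
  \<comment> \<open>Such a \<open>C\<close> contains \<open>z\<close>, and bracketing with \<open>z\<close> detects membership in \<open>K\<close>.\<close>
  have cartan_up: "cartan_subalgebra br UNIV C" if C: "cartan_subalgebra br ?K C" for C
  proof -
    have sub: "C \<subseteq> ?K" and nil: "nilpotent_subalgebra br C" and norm: "lie_normalizer br ?K C = C"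
      using C by (auto simp: cartan_subalgebra_def)
    have sC: "subspace C" using nil by (simp add: nilpotent_subalgebra_def lie_subalgebra_def)
    have zh: "br z h = 0" if "h \<in> ?K" for h using that zK by blast
    have "z \<in> lie_normalizer br ?K C"
      using zc sub zh subspace_0[OF sC] by (auto simp: lie_normalizer_def lie_centre_def)
    then have "z \<in> C" using norm by simp
    have "x \<in> C" if x: "\<And>h. h \<in> C \<Longrightarrow> br x h \<in> C" for x
    proof -
      have "br x z \<in> ?K" using x[OF \<open>z \<in> C\<close>] sub by blast
      then have "br z x \<in> ?K"
        using br_anti[of z x] subK by (simp add: lie_subalgebra_def subspace_neg)
      then have "x \<in> ?K" using KP[OF _ zP[of x]] zK[of x] by blast
      then have "x \<in> lie_normalizer br ?K C" using x by (simp add: lie_normalizer_def)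
      then show ?thesis using norm by simp
    qed
    moreover have "br x h \<in> C" if "x \<in> C" "h \<in> C" for x h
      using that nil by (simp add: nilpotent_subalgebra_def lie_subalgebra_def)
    ultimately have "lie_normalizer br UNIV C = C" unfolding lie_normalizer_def by blast
    then show ?thesis using nil by (simp add: cartan_subalgebra_def)
  qed
  obtain C where C: "cartan_subalgebra br ?K C" using cartan_subalgebra_exists[OF subK] by blast
  have "has_lie_rank br UNIV (dim C)"
    unfolding has_lie_rank_def using cartan_up[OF C] cartan_dim_unique[OF _ cartan_up[OF C]] by blast
  moreover have "has_lie_rank br ?K (dim C)"
    unfolding has_lie_rank_def using C cartan_dim_unique[OF cartan_up cartan_up[OF C]] by blast
  ultimately have "\<exists>r. has_lie_rank br ?K r \<and> has_lie_rank br UNIV r" by blast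
  then show ?thesis using part1 by simp
qed

end
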